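(* Let $5 \le k \le 25$. There exist a density $\alpha > 0$ and an on-line strategy for the $t=2$ choice $k$-SAT Achlioptas process such that, with $m = \lfloor \alpha n \rfloor$, the uniformly random formula $F_k(n,m)$ is unsatisfiable with probability tending to $1$ as $n \to \infty$, while the formula produced by the strategy is satisfiable with probability tending to $1$ as $n \to \infty$.
   Context: Fix $n$ Boolean variables $x_1,\dots,x_n$. A $k$-clause is a disjunction of $k$ literals on $k$ distinct variables; there are $2^k\binom{n}{k}$ of them. The random formula $F_k(n,m)$ is the conjunction of $m$ clauses, each chosen independently and uniformly from these $2^k\binom{n}{k}$ clauses. In the $t$-choice Achlioptas process for $k$-SAT, for each step $i = 1,\dots,m$ one is presented with $t$ independent, uniformly random $k$-clauses; a strategy selects one of them (its choice may depend on all clauses presented and selected at earlier steps and on the current $t$ clauses, but not on future ones) and adds it to the formula, discarding the others. After $m$ steps the result is a $k$-SAT formula with $m$ clauses on the variables $x_1,\dots,x_n$. *)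

theory Defs
  imports "HOL-Probability.Probability"
begin

text \<open>The literal \<open>(x, True)\<close> is the variable \<open>x\<close>, and \<open>(x, False)\<close> its negation.\<close>

type_synonym literal = "nat \<times> bool"
type_synonym clause = "literal set"

text \<open>Injectivity of \<open>fst\<close> says that the \<open>k\<close> literals are on distinct variables.\<close>

definition k_clauses :: "nat \<Rightarrow> nat \<Rightarrow> clause set" where
  "k_clauses n k = {C. C \<subseteq> {1..n} \<times> UNIV \<and> card C = k \<and> inj_on fst C}"

lemma card_k_clauses: "card (k_clauses n k) = 2 ^ k * (n choose k)"
proof -
  define A where "A = {V. V \<subseteq> {1..n} \<and> card V = k}"
  define g :: "nat set \<times> nat set \<Rightarrow> clause"
    where "g = (\<lambda>(V, P). (\<lambda>x. (x, x \<in> P)) ` V)"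
  have fin: "finite V" if "V \<in> A" for V
    using that unfolding A_def by (blast intro: finite_subset)
  have fst_g: "fst ` g (V, P) = V" for V P
    by (force simp: g_def)
  have pos_g: "{x. (x, True) \<in> g (V, P)} = V \<inter> P" for V P
    by (auto simp: g_def)
  have "inj_on g (Sigma A Pow)"
  proof (rule inj_onI, clarify)
    fix V P V' P'
    assume "P \<subseteq> V" "P' \<subseteq> V'" "g (V, P) = g (V', P')"
    then show "V = V' \<and> P = P'"
      using fst_g[of V P] fst_g[of V' P'] pos_g[of V P] pos_g[of V' P'] by auto
  qed
  moreover have "g ` Sigma A Pow = k_clauses n k"
  proof (intro equalityI subsetI)
    fix C assume "C \<in> g ` Sigma A Pow"
    then show "C \<in> k_clauses n k"
      by (auto simp: A_def g_def k_clauses_def inj_on_def card_image)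
  next
    fix C assume C: "C \<in> k_clauses n k"
    have "C = g (fst ` C, {x. (x, True) \<in> C})"
    proof (intro equalityI subsetI)
      fix l assume l: "l \<in> C"
      have "snd l = ((fst l, True) \<in> C)"
        using C l by (cases l; cases "snd l") (fastforce simp: k_clauses_def inj_on_def)+
      then have "l = (fst l, fst l \<in> {x. (x, True) \<in> C})"
        by (simp add: prod_eq_iff)
      then show "l \<in> g (fst ` C, {x. (x, True) \<in> C})"
        using l unfolding g_def by auto
    next
      fix l assume "l \<in> g (fst ` C, {x. (x, True) \<in> C})"
      then obtain x b where x: "(x, b) \<in> C" and l: "l = (x, (x, True) \<in> C)"
        by (auto simp: g_def)
      show "l \<in> C"
        using x l by (cases b; cases "(x, True) \<in> C") auto
    qed
    moreover have "(fst ` C, {x. (x, True) \<in> C}) \<in> Sigma A Pow"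
      using C by (force simp: A_def k_clauses_def card_image)
    ultimately show "C \<in> g ` Sigma A Pow" by blast
  qed
  ultimately have "card (k_clauses n k) = card (Sigma A Pow)"
    by (metis card_image)
  also have "\<dots> = (\<Sum>V\<in>A. card (Pow V))"
    using fin by (intro card_SigmaI) (auto simp: A_def)
  also have "\<dots> = (\<Sum>V\<in>A. 2 ^ k)"
  proof (rule sum.cong)
    fix V assume "V \<in> A"
    with fin show "card (Pow V) = 2 ^ k"
      by (subst card_Pow) (auto simp: A_def)
  qed simp
  also have "\<dots> = 2 ^ k * (n choose k)"
    by (simp add: A_def n_subsets)
  finally show ?thesis .
qed

text \<open>A formula is the conjunction of a list of clauses; repetitions are allowed.\<close>

definition satisfiable :: "clause list \<Rightarrow> bool" where
  "satisfiable F \<longleftrightarrow> (\<exists>a :: nat \<Rightarrow> bool. \<forall>C\<in>set F. \<exists>(x, b)\<in>C. a x = b)"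

text \<open>For \<open>n < k\<close> there are no \<open>k\<close>-clauses and the following distributions carry no meaning;
  this is irrelevant for limits as \<open>n\<close> tends to infinity.\<close>

definition random_clause :: "nat \<Rightarrow> nat \<Rightarrow> clause pmf" where
  "random_clause n k = pmf_of_set (k_clauses n k)"

definition random_formula :: "nat \<Rightarrow> nat \<Rightarrow> nat \<Rightarrow> clause list pmf" where
  "random_formula k n m = replicate_pmf m (random_clause n k)"

text \<open>A history lists, in chronological order, the clauses presented at each earlier step together
  with the one selected. An on-line strategy maps the history and the list of clauses currently
  presented to the selected clause.\<close>

type_synonym history = "(clause list \<times> clause) list"
type_synonym strategy = "history \<Rightarrow> clause list \<Rightarrow> clause"

definition is_strategy :: "nat \<Rightarrow> strategy \<Rightarrow> bool" where
  "is_strategy t S \<longleftrightarrow> (\<forall>h cs. length cs = t \<longrightarrow> S h cs \<in> set cs)"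

primrec achlioptas_process :: "nat \<Rightarrow> nat \<Rightarrow> nat \<Rightarrow> strategy \<Rightarrow> nat \<Rightarrow> history pmf" where
  "achlioptas_process t k n S 0 = return_pmf []"
| "achlioptas_process t k n S (Suc m) =
     do {
       h \<leftarrow> achlioptas_process t k n S m;
       cs \<leftarrow> replicate_pmf t (random_clause n k);
       return_pmf (h @ [(cs, S h cs)])
     }"

definition achlioptas_formula :: "nat \<Rightarrow> nat \<Rightarrow> nat \<Rightarrow> strategy \<Rightarrow> nat \<Rightarrow> clause list pmf" where
  "achlioptas_formula t k n S m = map_pmf (map snd) (achlioptas_process t k n S m)"

end

(*
  The density is 25/36 * 2^k. Since ln 2 <= 25/36, a union bound over the 2^n assignments makes the
  random formula unsatisfiable.

  For the strategy, every literal gets one of eight types with a fixed weight: variables are split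
  into four classes by their residue mod 4, and in each class positive literals are light and
  negative ones heavy. Of the two clauses presented, the strategy takes the one whose two lightest
  literals have the smaller product of weights. Replacing each selected clause by its two lightest
  literals only makes satisfaction harder and leaves independent 2-clauses. The expected number of
  implications from a literal of type a to literals of type b is, up to o(1), an 8 x 8 matrix
  depending on k alone, and the k-th powers of the weights form a strict supersolution, so that its
  spectral radius is below 1; this is checked numerically for each k. (For k = 5 the ratio is
  0.9995, for k = 6 already 0.68.)

  An unsatisfiable 2-SAT formula contains a walk of implications from y to neg y which goes on until
  it meets one of its earlier variables. These two coincidences cost a factor O(1/n) each, there
  are 2n choices for y, and subcriticality makes the sum over all lengths converge, so the expected
  number of such walks is O(1/n).
*)

theory Submission
  imports Defs "HOL-Real_Asymp.Real_Asymp"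
begin

section \<open>Implication walks in unsatisfiable 2-SAT formulas\<close>

text \<open>The cost of a clause is a product because implications come in contrapositive pairs. If
  x is the right Perron eigenvector of the implication matrix, then u \<mapsto> x (neg u) is its
  left eigenvector. Adding a clause u \<or> v, that is, the implications neg u -> v and neg v -> u,
  therefore raises the spectral radius, to first order, in proportion to x u * x v. Taking the
  smaller product is the greedy choice. The weights should be a fixed point: they determine the
  strategy, which determines the matrix, whose eigenvector should return them. Comparing products of
  weights or of their k-th powers is the same, so one rule serves all k. The bias works as follows:
  implications mostly end in light literals, and few implications start there, because the negation
  of a light literal is heavy and seldom among the two lightest of a selected clause. The density
  has to lie just above \<open>2 ^ k * ln 2\<close>, where the union bound starts to work; 25/36
  exceeds ln 2 by about 0.0013, which is small enough for the tight case k = 5.\<close>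

definition neg :: "literal \<Rightarrow> literal" where
  "neg l = (fst l, \<not> snd l)"

lemma neg_neg [simp]: "neg (neg l) = l"
  by (simp add: neg_def)

lemma fst_neg [simp]: "fst (neg l) = fst l"
  by (simp add: neg_def)

lemma neg_neq [simp]: "neg l \<noteq> l" "l \<noteq> neg l"
  by (auto simp: neg_def prod_eq_iff)

lemma neg_eq_iff [simp]: "neg l = neg l' \<longleftrightarrow> l = l'"
  by (auto simp: neg_def prod_eq_iff)

lemma fst_eq_fst_iff: "fst l = fst l' \<longleftrightarrow> l = l' \<or> l = neg l'"
  by (auto simp: neg_def prod_eq_iff)

definition lit_true :: "(nat \<Rightarrow> bool) \<Rightarrow> literal \<Rightarrow> bool" where
  "lit_true a l \<longleftrightarrow> a (fst l) = snd l"

definition sat2 :: "(literal \<times> literal) set \<Rightarrow> bool" where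
  "sat2 P \<longleftrightarrow> (\<exists>a. \<forall>(u, v)\<in>P. lit_true a u \<or> lit_true a v)"

definition imps :: "(literal \<times> literal) set \<Rightarrow> literal rel" where
  "imps P = {(u, v). (neg u, v) \<in> P \<or> (v, neg u) \<in> P}"

lemma imps_contrapos: "(u, v) \<in> imps P \<Longrightarrow> (neg v, neg u) \<in> imps P"
  by (auto simp: imps_def)

lemma imps_rtrancl_contrapos:
  assumes "(u, v) \<in> (imps P)\<^sup>*"
  shows "(neg v, neg u) \<in> (imps P)\<^sup>*"
  using assms
  by (induction rule: rtrancl_induct) (auto intro: imps_contrapos converse_rtrancl_into_rtrancl)

text \<open>A maximal consistent set of literals closed under implication decides every variable: if
  a variable is undecided, one of its literals y does not imply \<open>neg y\<close>, and y can be
  added together with all its consequences.\<close>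

lemma sat2_if_no_contradictory_cycle:
  assumes fin: "finite P"
    and acyc: "\<And>y. (y, neg y) \<in> (imps P)\<^sup>* \<Longrightarrow> (neg y, y) \<in> (imps P)\<^sup>* \<Longrightarrow> False"
  shows "sat2 P"
proof -
  define R where "R = (imps P)\<^sup>*"
  define X where "X = fst ` (fst ` P \<union> snd ` P)"
  define Cons where "Cons = {T. T \<subseteq> X \<times> UNIV \<and> R `` T \<subseteq> T \<and> (\<forall>u\<in>T. neg u \<notin> T)}"
  have finX: "finite (X \<times> (UNIV :: bool set))"
    unfolding X_def using fin by auto
  have "{} \<in> Cons" by (auto simp: Cons_def)
  moreover have "finite Cons"
    by (rule finite_subset[of _ "Pow (X \<times> UNIV)"]) (use finX in \<open>auto simp: Cons_def\<close>)
  ultimately obtain T where T: "T \<in> Cons" and max: "\<And>T'. T' \<in> Cons \<Longrightarrow> T \<subseteq> T' \<Longrightarrow> T' = T"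
    using finite_has_maximal2[of Cons "{}"] by metis
  have TX: "T \<subseteq> X \<times> UNIV" and cl: "R `` T \<subseteq> T" and con: "\<And>u. u \<in> T \<Longrightarrow> neg u \<notin> T"
    using T by (auto simp: Cons_def)
  have contra: "(neg v, neg u) \<in> R" if "(u, v) \<in> R" for u v
    using that imps_rtrancl_contrapos by (auto simp: R_def)
  have trans: "(u, w) \<in> R" if "(u, v) \<in> R" "(v, w) \<in> R" for u v w
    using that by (auto simp: R_def)
  have PX: "fst u \<in> X" "fst v \<in> X" if "(u, v) \<in> P" for u v
    using that unfolding X_def by (metis Un_iff fst_conv image_eqI snd_conv)+
  have inX: "fst v \<in> X" if "(u, v) \<in> R" "fst u \<in> X" for u v
    using that unfolding R_def
  proof (induction rule: rtrancl_induct)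
    case (step v w)
    then show ?case using PX unfolding imps_def by blast
  qed
  have decided: "z \<in> T \<or> neg z \<in> T" if z: "fst z \<in> X" for z
  proof (rule ccontr)
    assume nz: "\<not> (z \<in> T \<or> neg z \<in> T)"
    have "\<exists>y. (y = z \<or> y = neg z) \<and> (y, neg y) \<notin> R"
      using acyc[of z] neg_neg[of z] unfolding R_def by metis
    then obtain y where y: "(y, neg y) \<notin> R" "y \<notin> T" "neg y \<notin> T" "fst y \<in> X"
      using nz z by (metis fst_neg neg_neg)
    define T' where "T' = T \<union> R `` {y}"
    have "T' \<subseteq> X \<times> UNIV"
      using TX inX[OF _ y(4)] by (fastforce simp: T'_def)
    moreover have "R `` T' \<subseteq> T'"
      using cl trans unfolding T'_def by blast
    moreover have "neg u \<notin> T'" if u: "u \<in> T'" for u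
    proof
      assume u': "neg u \<in> T'"
      \<comment> \<open>By contraposition v would imply \<open>neg y\<close>, and the closed set T
        would already decide the variable of y.\<close>
      have *: False if "v \<in> T" "(y, neg v) \<in> R" for v
      proof -
        have "(v, neg y) \<in> R" using contra[OF that(2)] by simp
        then show False using cl that(1) y(3) by blast
      qed
      \<comment> \<open>The contrapositive of y -> \<open>neg u\<close> is u ->
        \<open>neg y\<close>; chained after y -> u it gives y -> \<open>neg y\<close>.\<close>
      have "\<not> ((y, u) \<in> R \<and> (y, neg u) \<in> R)"
        using contra[of y "neg u"] trans[of y u "neg y"] y(1) by auto
      then show False
        using u u' *[of u] *[of "neg u"] con[of u] unfolding T'_def by auto
    qed
    ultimately have "T' \<in> Cons" unfolding Cons_def by blast
    moreover have "y \<in> R `` {y}" by (auto simp: R_def)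
    ultimately show False using max[of T'] y(2) unfolding T'_def by blast
  qed
  define a where "a = (\<lambda>x. (x, True) \<in> T)"
  have a: "lit_true a u" if "u \<in> T" for u
    using that con[of u] by (cases u; cases "snd u") (auto simp: lit_true_def a_def neg_def)
  have "lit_true a u \<or> lit_true a v" if "(u, v) \<in> P" for u v
  proof (cases "u \<in> T")
    case False
    then have "neg u \<in> T" using PX[OF that] decided[of u] by auto
    moreover have "(neg u, v) \<in> R"
      unfolding R_def by (rule r_into_rtrancl) (use that in \<open>auto simp: imps_def\<close>)
    ultimately have "v \<in> T" using cl by blast
    then show ?thesis using a by blast
  qed (use a in auto)
  then show ?thesis unfolding sat2_def by blast
qed

text \<open>The second part of the walk cannot be omitted: the expected number of walks from a literal
  to its negation is bounded but does not tend to zero.\<close>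

definition hooked :: "nat \<Rightarrow> nat \<Rightarrow> (nat \<Rightarrow> literal) \<Rightarrow> bool" where
  "hooked l N s \<longleftrightarrow> 0 < l \<and> l < N \<and> s l = neg (s 0) \<and> inj_on (fst \<circ> s) ({..<N} - {l}) \<and>
     fst (s N) \<in> (fst \<circ> s) ` {..<N} \<and> (\<forall>i<N. fst (s i) \<noteq> fst (s (Suc i)))"

lemma rtrancl_fun:
  assumes "(a, b) \<in> R\<^sup>*"
  obtains f :: "nat \<Rightarrow> 'a" and n where "f 0 = a" "f n = b" "\<And>i. i < n \<Longrightarrow> (f i, f (Suc i)) \<in> R"
  using assms unfolding rtrancl_power relpow_fun_conv by blast

lemma walk_rtrancl:
  assumes "\<And>i. i < n \<Longrightarrow> (f i, f (Suc i)) \<in> R" "i \<le> j" "j \<le> n"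
  shows "(f i, f j) \<in> R\<^sup>*"
  using assms(2,3)
proof (induction rule: dec_induct)
  case (step m)
  then show ?case using assms(1)[of m] by (auto intro: rtrancl_into_rtrancl)
qed simp

lemma walk_relpow:
  assumes "\<And>i. i < n \<Longrightarrow> (f i, f (Suc i)) \<in> R" "i \<le> j" "j \<le> n"
  shows "(f i, f j) \<in> R ^^ (j - i)"
  unfolding relpow_fun_conv using assms
  by (intro exI[of _ "\<lambda>p. f (i + p)"]) auto

text \<open>A shortest walk from a contradictory literal to its negation has distinct variables:
  between two equal literals it could be cut short, and between two complementary ones lies a
  shorter walk of the same kind. It is continued towards y, and stopped at the first repeated
  variable after position l.\<close>

lemma hooked_walk_if_not_sat2:
  assumes fin: "finite P" and unsat: "\<not> sat2 P"
    and irrefl: "\<And>u v. (u, v) \<in> P \<Longrightarrow> fst u \<noteq> fst v"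
  obtains l N s where "hooked l N s" "\<And>i. i < N \<Longrightarrow> (s i, s (Suc i)) \<in> imps P"
proof -
  define R where "R = imps P"
  define K where "K = {y. (y, neg y) \<in> R\<^sup>* \<and> (neg y, y) \<in> R\<^sup>*}"
  define Q where "Q = (\<lambda>n. \<exists>y\<in>K. (y, neg y) \<in> R ^^ n)"
  have "\<exists>y. y \<in> K"
    using sat2_if_no_contradictory_cycle[OF fin] unsat unfolding K_def R_def by blast
  then have "\<exists>n. Q n" unfolding Q_def K_def rtrancl_power by blast
  define l where "l = (LEAST n. Q n)"
  have Ql: "Q l" unfolding l_def using \<open>\<exists>n. Q n\<close> by (rule LeastI_ex)
  have l_le: "l \<le> n" if "Q n" for n unfolding l_def using that by (rule Least_le)
  from Ql obtain y f where y: "y \<in> K" and f: "f 0 = y" "f l = neg y"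
    and fR: "\<And>i. i < l \<Longrightarrow> (f i, f (Suc i)) \<in> R"
    unfolding Q_def relpow_fun_conv by blast
  have l0: "0 < l" using f by (cases l) auto
  have contra: "(neg v, neg u) \<in> R\<^sup>*" if "(u, v) \<in> R\<^sup>*" for u v
    using that imps_rtrancl_contrapos by (auto simp: R_def)
  \<comment> \<open>Every literal on the walk is contradictory itself, so its subwalks compete in
    the minimality of l.\<close>
  have fK: "f i \<in> K" if "i \<le> l" for i
  proof -
    have 1: "(y, f i) \<in> R\<^sup>*" "(f i, neg y) \<in> R\<^sup>*"
      using walk_rtrancl[of l f R 0 i] walk_rtrancl[of l f R i l] fR that f by auto
    from contra[OF this(1)] contra[OF this(2)]
    have "(neg (f i), neg y) \<in> R\<^sup>*" "(y, neg (f i)) \<in> R\<^sup>*" by auto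
    with 1 y show ?thesis unfolding K_def by (auto intro: rtrancl_trans)
  qed
  have inj_f: "False" if ij: "i < j" "j < l" "fst (f i) = fst (f j)" for i j
  proof -
    consider "f j = f i" | "f j = neg (f i)" using ij fst_eq_fst_iff by metis
    then show False
    proof cases
      case 1
      have "(y, f i) \<in> R ^^ i" "(f i, neg y) \<in> R ^^ (l - j)"
        using walk_relpow[of l f R 0 i] walk_relpow[of l f R j l] fR f ij 1 by auto
      then have "(y, neg y) \<in> R ^^ (i + (l - j))" by (rule relpow_trans)
      then have "Q (i + (l - j))" using y unfolding Q_def by blast
      then show False using l_le ij by fastforce
    next
      case 2
      have "(f i, neg (f i)) \<in> R ^^ (j - i)"
        using walk_relpow[of l f R i j] fR ij 2 by auto
      then have "Q (j - i)" using fK[of i] ij unfolding Q_def by auto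
      then show False using l_le ij by fastforce
    qed
  qed
  from y have "(neg y, y) \<in> R\<^sup>*" unfolding K_def by blast
  then obtain g n where g: "g 0 = neg y" "g n = y" and gR: "\<And>i. i < n \<Longrightarrow> (g i, g (Suc i)) \<in> R"
    by (rule rtrancl_fun) blast
  define s where "s = (\<lambda>i. if i \<le> l then f i else g (i - l))"
  define H where "H = (\<lambda>N. l < N \<and> fst (s N) \<in> (fst \<circ> s) ` {..<N})"
  have n0: "0 < n" using g by (cases n) auto
  \<comment> \<open>A first repetition exists because the continued walk ends in y, the literal at
    position 0.\<close>
  have "H (l + n)" unfolding H_def s_def using n0 g f l0 by (auto intro!: image_eqI[of _ _ 0])
  define N where "N = (LEAST N. H N)"
  have HN: "H N" unfolding N_def using \<open>H (l + n)\<close> by (rule LeastI)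
  have N_le: "N \<le> l + n" unfolding N_def using \<open>H (l + n)\<close> by (rule Least_le)
  have notH: "\<not> H i" if "i < N" for i using not_less_Least that unfolding N_def by blast
  have sR: "(s i, s (Suc i)) \<in> R" if "i < N" for i
  proof (cases "i < l")
    case True
    then show ?thesis using fR by (auto simp: s_def)
  next
    case False
    then have "i = l \<or> l < i" by auto
    then show ?thesis
      using gR[of "i - l"] that N_le f g n0 by (auto simp: s_def Suc_diff_le)
  qed
  have irreflR: "fst u \<noteq> fst v" if "(u, v) \<in> R" for u v
    using that irrefl unfolding R_def imps_def by fastforce
  have inj: "inj_on (fst \<circ> s) ({..<N} - {l})"
  proof (rule linorder_inj_onI)
    fix i j assume ij: "i < j" "i \<in> {..<N} - {l}" "j \<in> {..<N} - {l}"
    show "(fst \<circ> s) i \<noteq> (fst \<circ> s) j"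
    proof (cases "j < l")
      case True
      then show ?thesis using inj_f[of i j] ij by (auto simp: s_def)
    next
      case False
      then have "fst (s j) \<notin> (fst \<circ> s) ` {..<j}" using notH[of j] ij unfolding H_def by auto
      then show ?thesis using ij by (metis comp_apply image_eqI lessThan_iff)
    qed
  qed auto
  have "hooked l N s"
    unfolding hooked_def using l0 HN inj irreflR sR f by (auto simp: H_def s_def)
  then show thesis using that sR unfolding R_def by blast
qed

text \<open>An implication and its contrapositive have the same event, since both stem from one
  clause. Hence distinct steps of a walk need not have disjoint events in general.\<close>

definition edge_event :: "literal \<Rightarrow> literal \<Rightarrow> (literal \<times> literal) set" where
  "edge_event u v = {(neg u, v), (v, neg u)}"

text \<open>The events of steps i < j meet only if the steps are equal or contrapositive, so only if
  \<open>s i = s j\<close> or \<open>s (Suc i) = neg (s j)\<close>. All positions involved lie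
  before N, where variables repeat only between 0 and l, and there the literals are complementary.
  The repeated variable at N is never compared.\<close>

lemma disjoint_family_on_hooked:
  assumes "hooked l N s"
  shows "disjoint_family_on (\<lambda>i. edge_event (s i) (s (Suc i))) {..<N}"
proof -
  have l: "0 < l" "l < N" and sl: "s l = neg (s 0)"
    and inj: "\<And>i j. fst (s i) = fst (s j) \<Longrightarrow> i < N \<Longrightarrow> j < N \<Longrightarrow> i \<noteq> l \<Longrightarrow> j \<noteq> l \<Longrightarrow> i = j"
    and ne: "\<And>i. i < N \<Longrightarrow> fst (s i) \<noteq> fst (s (Suc i))"
    using assms unfolding hooked_def inj_on_def by auto
  have inj': "i = j \<or> {i, j} = {0, l}" if "fst (s i) = fst (s j)" "i < N" "j < N" for i j
  proof -
    have "fst (s l) = fst (s 0)" using sl by (metis fst_neg)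
    then show ?thesis
      using inj[of i j] inj[of 0 i] inj[of 0 j] that l by (metis insert_commute less_trans nat_neq_iff)
  qed
  have *: "edge_event (s i) (s (Suc i)) \<inter> edge_event (s j) (s (Suc j)) = {}" if ij: "i < j" "j < N" for i j
  proof (rule ccontr)
    assume "\<not> ?thesis"
    then consider "s i = s j" | "s (Suc i) = neg (s j)"
      unfolding edge_event_def by auto
    then show False
    proof cases
      case 1
      then have "i = 0 \<and> j = l" using inj'[of i j] ij by (auto simp: doubleton_eq_iff)
      with 1 sl show False by simp
    next
      case 2
      then have "Suc i = j" using inj'[of "Suc i" j] ij by (auto simp: doubleton_eq_iff)
      with 2 show False by simp
    qed
  qed
  show ?thesis unfolding disjoint_family_on_def
    using * by (metis Int_commute lessThan_iff nat_neq_iff)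
qed

section \<open>The first moment method for random 2-SAT\<close>

lemma measure_bind_pmf_eq:
  "measure_pmf.prob (bind_pmf p f) A = (\<integral>x. measure_pmf.prob (f x) A \<partial>measure_pmf p)"
proof -
  have *: "measure_pmf.prob q A = pmf (map_pmf (\<lambda>x. x \<in> A) q) True" for q :: "'a pmf"
    by (simp add: pmf_map vimage_def)
  show ?thesis unfolding * map_bind_pmf by (simp add: pmf_bind)
qed

lemma integrable_measure_pmf_bounded:
  fixes f :: "'a \<Rightarrow> real"
  assumes "\<And>x. \<bar>f x\<bar> \<le> B"
  shows "integrable (measure_pmf p) f"
  by (rule measure_pmf.integrable_const_bound[where B = B]) (use assms in auto)

text \<open>These are the first two terms of a binomial expansion; they carry the induction on the
  number of samples below.\<close>

lemma power_Suc_ge_derivative: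
  "real m ^ n + real n * real m ^ (n - 1) \<le> real (Suc m) ^ n"
proof (induction n)
  case (Suc n)
  have "real m ^ Suc n + real (Suc n) * real m ^ n = real m * real m ^ n + real n * real m ^ n + real m ^ n"
    by (simp add: algebra_simps)
  also have "real n * real m ^ n = real m * (real n * real m ^ (n - 1))"
    by (cases n) auto
  also have "real m * real m ^ n + real m * (real n * real m ^ (n - 1)) + real m ^ n
      \<le> real m * real (Suc m) ^ n + real (Suc m) ^ n"
    using mult_left_mono[OF Suc, of "real m"] power_mono[of "real m" "real (Suc m)" n]
    by (simp add: algebra_simps)
  also have "\<dots> = real (Suc m) ^ Suc n" by (simp add: algebra_simps)
  finally show ?case by simp
qed simp

text \<open>Disjoint events must be hit by distinct samples. There are at most
  \<open>m ^ card I\<close> ways to assign samples to events, and by independence each succeeds with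
  the product of the probabilities. The induction conditions on the first sample, which hits at most
  one of the events.\<close>

lemma prob_hit_disjoint_events_le:
  fixes D :: "'a pmf" and E :: "'i \<Rightarrow> 'a set"
  assumes "finite I" "disjoint_family_on E I"
  shows "measure_pmf.prob (replicate_pmf m D) {\<omega>. \<forall>i\<in>I. \<exists>d\<in>set \<omega>. d \<in> E i}
    \<le> real m ^ card I * (\<Prod>i\<in>I. measure_pmf.prob D (E i))"
  using assms
proof (induction m arbitrary: I)
  case 0
  show ?case
  proof (cases "I = {}")
    case False
    then show ?thesis using 0 by (simp add: card_gt_0_iff zero_power)
  qed simp
next
  case (Suc m)
  define H where "H = (\<lambda>I. {\<omega>. \<forall>i\<in>I. \<exists>d\<in>set \<omega>. d \<in> E i})"
  define P where "P = (\<lambda>I. measure_pmf.prob (replicate_pmf m D) (H I))"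
  define p where "p = (\<lambda>i. measure_pmf.prob D (E i))"
  have p0: "0 \<le> p i" for i by (simp add: p_def)
  have IH: "P J \<le> real m ^ card J * (\<Prod>i\<in>J. p i)" if "J \<subseteq> I" for J
    unfolding P_def p_def H_def using that Suc.prems
    by (intro Suc.IH) (auto intro: finite_subset disjoint_family_on_mono)
  have step: "measure_pmf.prob (replicate_pmf m D) {\<omega>. d # \<omega> \<in> H I}
      \<le> P I + (\<Sum>i\<in>I. indicator (E i) d * P (I - {i}))" for d
  proof (cases "\<exists>i\<in>I. d \<in> E i")
    case False
    then have "{\<omega>. d # \<omega> \<in> H I} = H I" by (auto simp: H_def)
    then show ?thesis
      by (simp add: P_def sum_nonneg)
  next
    case True
    then obtain i where i: "i \<in> I" "d \<in> E i" by blast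
    have uniq: "j = i" if "j \<in> I" "d \<in> E j" for j
      using Suc.prems(2) i that unfolding disjoint_family_on_def by blast
    have "{\<omega>. d # \<omega> \<in> H I} \<subseteq> H (I - {i})"
      using uniq by (auto simp: H_def)
    then have "measure_pmf.prob (replicate_pmf m D) {\<omega>. d # \<omega> \<in> H I} \<le> P (I - {i})"
      unfolding P_def by (intro measure_pmf.finite_measure_mono) auto
    also have "\<dots> = indicator (E i) d * P (I - {i})" using i by simp
    also have "\<dots> \<le> (\<Sum>i\<in>I. indicator (E i) d * P (I - {i}))"
      using i Suc.prems(1)
      by (intro member_le_sum) (auto simp: P_def)
    also have "\<dots> \<le> P I + \<dots>" by (simp add: P_def)
    finally show ?thesis .
  qed
  have int: "integrable (measure_pmf D) (\<lambda>d. indicator (E i) d * P J)" for i J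
    by (intro integrable_measure_pmf_bounded[where B = 1]) (auto simp: P_def indicator_def)
  have "measure_pmf.prob (replicate_pmf (Suc m) D) (H I)
      = (\<integral>d. measure_pmf.prob (replicate_pmf m D) {\<omega>. d # \<omega> \<in> H I} \<partial>measure_pmf D)"
    by (simp add: measure_bind_pmf_eq flip: map_pmf_def) (simp add: vimage_def)
  also have "\<dots> \<le> (\<integral>d. P I + (\<Sum>i\<in>I. indicator (E i) d * P (I - {i})) \<partial>measure_pmf D)"
  proof (rule integral_mono)
    show "integrable (measure_pmf D) (\<lambda>d. P I + (\<Sum>i\<in>I. indicator (E i) d * P (I - {i})))"
      using int by (intro Bochner_Integration.integrable_add Bochner_Integration.integrable_sum) auto
    show "integrable (measure_pmf D) (\<lambda>d. measure_pmf.prob (replicate_pmf m D) {\<omega>. d # \<omega> \<in> H I})"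
      by (rule integrable_measure_pmf_bounded[where B = 1]) auto
  qed (rule step)
  also have "\<dots> = P I + (\<Sum>i\<in>I. p i * P (I - {i}))"
    using int by (simp add: Bochner_Integration.integral_sum p_def)
  also have "\<dots> \<le> real m ^ card I * (\<Prod>i\<in>I. p i) + (\<Sum>i\<in>I. real m ^ (card I - 1) * (\<Prod>i\<in>I. p i))"
  proof (intro add_mono sum_mono IH order_refl)
    fix i assume i: "i \<in> I"
    have "p i * P (I - {i}) \<le> p i * (real m ^ card (I - {i}) * (\<Prod>i\<in>I - {i}. p i))"
      by (intro mult_left_mono IH p0) auto
    also have "\<dots> = real m ^ (card I - 1) * (\<Prod>i\<in>I. p i)"
      using i Suc.prems(1) by (simp add: prod.remove[of I i])
    finally show "p i * P (I - {i}) \<le> real m ^ (card I - 1) * (\<Prod>i\<in>I. p i)" .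
  qed
  also have "\<dots> = (real m ^ card I + real (card I) * real m ^ (card I - 1)) * (\<Prod>i\<in>I. p i)"
    by (simp add: algebra_simps)
  also have "\<dots> \<le> real (Suc m) ^ card I * (\<Prod>i\<in>I. p i)"
    by (intro mult_right_mono power_Suc_ge_derivative prod_nonneg) (use p0 in auto)
  finally show ?case unfolding H_def p_def .
qed

section \<open>Sums of walk weights under a supersolution\<close>

fun walk_weight :: "('a \<Rightarrow> 'a \<Rightarrow> real) \<Rightarrow> 'a \<Rightarrow> 'a list \<Rightarrow> real" where
  "walk_weight w u [] = 1"
| "walk_weight w u (v # vs) = w u v * walk_weight w v vs"

lemma walk_weight_append:
  "walk_weight w u (vs @ vs') = walk_weight w u vs * walk_weight w (last (u # vs)) vs'"
  by (induction vs arbitrary: u) auto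

lemma walk_weight_nth:
  "(\<Prod>i<length vs. w ((u # vs) ! i) ((u # vs) ! Suc i)) = walk_weight w u vs"
  by (induction vs arbitrary: u) (simp_all add: prod.lessThan_Suc_shift del: prod.lessThan_Suc)

lemma walk_weight_nonneg: "(\<And>u v. 0 \<le> w u v) \<Longrightarrow> 0 \<le> walk_weight w u vs"
  by (induction vs arbitrary: u) auto

definition lists_over :: "'a set \<Rightarrow> nat \<Rightarrow> 'a list set" where
  "lists_over A n = {xs. set xs \<subseteq> A \<and> length xs = n}"

lemma finite_lists_over: "finite A \<Longrightarrow> finite (lists_over A n)"
  unfolding lists_over_def by (rule finite_lists_length_eq)

lemma sum_lists_over_Suc:
  "(\<Sum>xs\<in>lists_over A (Suc n). f xs) = (\<Sum>x\<in>A. \<Sum>xs\<in>lists_over A n. f (x # xs))"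
proof -
  have "lists_over A (Suc n) = (\<lambda>(x, xs). x # xs) ` (A \<times> lists_over A n)"
    by (auto simp: lists_over_def length_Suc_conv image_iff)
  then show ?thesis
    by (simp add: sum.reindex inj_on_def case_prod_beta sum.cartesian_product)
qed

text \<open>The supersolution x takes the place of an eigenvector: starting from 1 \<le> x at the
  far end of the walk, each step back costs one factor \<rho> by the row inequality.\<close>

lemma sum_walk_weight_le:
  assumes nonneg: "\<And>u v. 0 \<le> w u v" and "0 \<le> \<rho>"
    and row: "\<And>u. u \<in> A \<Longrightarrow> (\<Sum>v\<in>A. w u v * x v) \<le> \<rho> * x u"
    and x: "\<And>u. u \<in> A \<Longrightarrow> 1 \<le> x u" and u: "u \<in> A"
  shows "(\<Sum>vs\<in>lists_over A n. walk_weight w u vs) \<le> \<rho> ^ n * x u"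
  using u
proof (induction n arbitrary: u)
  case 0
  have "lists_over A 0 = {[]}" by (auto simp: lists_over_def)
  then show ?case using x 0 by simp
next
  case (Suc n)
  have "(\<Sum>vs\<in>lists_over A (Suc n). walk_weight w u vs)
      = (\<Sum>v\<in>A. w u v * (\<Sum>vs\<in>lists_over A n. walk_weight w v vs))"
    by (simp add: sum_lists_over_Suc sum_distrib_left)
  also have "\<dots> \<le> (\<Sum>v\<in>A. w u v * (\<rho> ^ n * x v))"
    by (intro sum_mono mult_left_mono Suc.IH nonneg)
  also have "\<dots> = \<rho> ^ n * (\<Sum>v\<in>A. w u v * x v)"
    by (simp add: sum_distrib_left mult_ac)
  also have "\<dots> \<le> \<rho> ^ n * (\<rho> * x u)"
    using \<open>0 \<le> \<rho>\<close> Suc.prems by (intro mult_left_mono row) auto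
  finally show ?case by (simp add: mult_ac)
qed

text \<open>A differentiated geometric series. The linear factor will count the earlier variables at
  which a walk can close.\<close>

lemma sum_Suc_power_le:
  fixes z :: real
  assumes "0 \<le> z" "z < 1"
  shows "(\<Sum>a<n. real (Suc a) * z ^ a) \<le> 1 / (1 - z)\<^sup>2"
proof -
  have "(\<lambda>a. real (Suc a) * z ^ a) sums (1 / (1 - z)\<^sup>2)"
    using geometric_deriv_sums[of z] assms by simp
  then show ?thesis
    using sum_le_suminf[of "\<lambda>a. real (Suc a) * z ^ a" "{..<n}"] assms
    by (auto simp: sums_iff)
qed

section \<open>Union bound over hooked walks\<close>

definition hook_list :: "literal \<times> literal list \<times> literal list \<times> literal \<Rightarrow> literal list" where
  "hook_list = (\<lambda>(y, ws, zs, z). y # ws @ neg y # zs @ [z])"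

definition hooks :: "literal set \<Rightarrow> nat \<Rightarrow> nat \<Rightarrow> (literal \<times> literal list \<times> literal list \<times> literal) set" where
  "hooks L a b = (SIGMA y:L. SIGMA ws:lists_over L a. SIGMA zs:lists_over L b.
     {z \<in> L. fst z \<in> fst ` set (y # ws @ zs)})"

definition hook_event :: "literal \<times> literal list \<times> literal list \<times> literal \<Rightarrow> (literal \<times> literal) list set" where
  "hook_event h = {\<omega>. \<forall>i<length (hook_list h) - 1.
     \<exists>d\<in>set \<omega>. d \<in> edge_event (hook_list h ! i) (hook_list h ! Suc i)}"

text \<open>Distinctness of the variables is required here to bound the probability of one walk. The
  bounds are then summed over all of \<open>hooks\<close>, where \<open>ws\<close> and
  \<open>zs\<close> vary freely and the sum factorises.\<close>

definition hooked_tuples :: "literal set \<Rightarrow> nat \<Rightarrow> nat \<Rightarrow> (literal \<times> literal list \<times> literal list \<times> literal) set" where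
  "hooked_tuples L a b = {h \<in> hooks L a b. hooked (Suc a) (a + b + 2) (\<lambda>i. hook_list h ! i)}"

lemma finite_hooks: "finite L \<Longrightarrow> finite (hooks L a b)"
  unfolding hooks_def by (intro finite_SigmaI finite_lists_over) auto

lemma imps_iff_edge_event: "(u, v) \<in> imps P \<longleftrightarrow> (\<exists>d\<in>P. d \<in> edge_event u v)"
  by (auto simp: imps_def edge_event_def)

lemma hooked_cong:
  assumes "\<And>i. i \<le> N \<Longrightarrow> s i = s' i" "hooked l N s"
  shows "hooked l N s'"
proof -
  have "inj_on (fst \<circ> s') ({..<N} - {l}) \<longleftrightarrow> inj_on (fst \<circ> s) ({..<N} - {l})"
    by (rule inj_on_cong) (use assms(1) in auto)
  moreover have "(fst \<circ> s') ` {..<N} = (fst \<circ> s) ` {..<N}"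
    by (rule image_cong) (use assms(1) in auto)
  ultimately show ?thesis using assms unfolding hooked_def by (auto simp: Suc_le_eq)
qed

text \<open>The variables before position N are distinct apart from the one at l, so both parts of
  the walk are shorter than \<open>card L\<close> and a finite union of events suffices.\<close>

lemma unsat_in_hook_events:
  assumes finL: "finite L" and negL: "neg ` L \<subseteq> L"
    and P: "set \<omega> \<subseteq> {(u, v). u \<in> L \<and> v \<in> L \<and> fst u \<noteq> fst v}"
    and unsat: "\<not> sat2 (set \<omega>)"
  shows "\<exists>a<card L. \<exists>b<card L. \<exists>h\<in>hooked_tuples L a b. \<omega> \<in> hook_event h"
proof -
  have irrefl: "fst u \<noteq> fst v" if "(u, v) \<in> set \<omega>" for u v
    using subsetD[OF P that] by simp
  obtain l N s where hk: "hooked l N s" and sR: "\<And>i. i < N \<Longrightarrow> (s i, s (Suc i)) \<in> imps (set \<omega>)"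
    using hooked_walk_if_not_sat2[OF finite_set unsat irrefl] by blast
  have l: "0 < l" "l < N" and sl: "s l = neg (s 0)" and inj: "inj_on (fst \<circ> s) ({..<N} - {l})"
    and last: "fst (s N) \<in> (fst \<circ> s) ` {..<N}"
    using hk unfolding hooked_def by auto
  have edgeL: "u \<in> L \<and> v \<in> L" if "(u, v) \<in> imps (set \<omega>)" for u v
  proof -
    have "neg u \<in> L \<and> v \<in> L" using that P unfolding imps_def by auto
    then show ?thesis using negL by (metis image_subset_iff neg_neg)
  qed
  have sL: "s i \<in> L" if "i \<le> N" for i
    using edgeL[OF sR[of i]] edgeL[OF sR[of "N - 1"]] that l by (cases "i = N") auto
  define a where "a = l - 1"
  define b where "b = N - l - 1"
  have la: "l = Suc a" and Nb: "N = a + b + 2" using l by (auto simp: a_def b_def)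
  have "card ({..<N} - {l}) \<le> card (fst ` L)"
    by (rule card_inj_on_le[OF inj]) (use sL finL in auto)
  also have "\<dots> \<le> card L" using finL by (rule card_image_le)
  finally have "N - 1 \<le> card L" using l by simp
  then have ab: "a < card L" "b < card L" using Nb by auto
  define h where "h = (s 0, map s [1..<l], map s [Suc l..<N], s N)"
  have split: "[0..<Suc N] = 0 # [1..<l] @ l # [Suc l..<N] @ [N]"
  proof -
    have "[0..<Suc N] = [0..<l] @ [l..<N] @ [N]"
      using l upt_add_eq_append[of 0 l "N - l"] by simp
    then show ?thesis using l by (simp add: upt_rec[of 0 l] upt_rec[of l N])
  qed
  have hl: "hook_list h = map s [0..<Suc N]"
    unfolding split by (simp add: hook_list_def h_def sl)
  have nth: "hook_list h ! i = s i" if "i \<le> N" for i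
    unfolding hl using that by (simp del: upt_Suc)
  have "h \<in> hooks L a b"
  proof -
    have "fst (s N) \<in> fst ` set (s 0 # map s [1..<l] @ map s [Suc l..<N])"
    proof -
      obtain j where j: "j < N" "fst (s N) = fst (s j)" using last by auto
      \<comment> \<open>Position l has the variable of position 0, so \<open>hooks\<close> may leave
        \<open>neg y\<close> out of the variables at which the walk closes.\<close>
      define j' where "j' = (if j = l then 0 else j)"
      have "fst (s N) = fst (s j')" using j sl by (auto simp: j'_def)
      moreover have "j' = 0 \<or> j' \<in> {1..<l} \<or> j' \<in> {Suc l..<N}"
        using j l by (auto simp: j'_def)
      ultimately show ?thesis by auto
    qed
    then show ?thesis
      using sL l by (auto simp: hooks_def h_def lists_over_def a_def b_def)
  qed
  moreover have "hooked (Suc a) (a + b + 2) (\<lambda>i. hook_list h ! i)"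
    using hooked_cong[OF _ hk, of "\<lambda>i. hook_list h ! i"] nth la Nb by simp
  moreover have "\<omega> \<in> hook_event h"
    unfolding hook_event_def using sR nth by (auto simp: hl imps_iff_edge_event simp del: upt_Suc)
  ultimately show ?thesis using ab unfolding hooked_tuples_def by blast
qed

lemma prob_hook_event_le:
  assumes h: "h \<in> hooked_tuples L a b"
    and w: "w = (\<lambda>u v. real m * measure_pmf.prob D (edge_event u v))"
  shows "measure_pmf.prob (replicate_pmf m D) (hook_event h)
    \<le> walk_weight w (hd (hook_list h)) (tl (hook_list h))"
proof -
  define xs where "xs = hook_list h"
  have len: "length xs = a + b + 3"
    using h by (auto simp: hooked_tuples_def hooks_def xs_def hook_list_def lists_over_def)
  have xs: "xs = hd xs # tl xs" using len by (cases xs) auto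
  define N where "N = a + b + 2"
  have ev: "hook_event h = {\<omega>. \<forall>i\<in>{..<N}. \<exists>d\<in>set \<omega>. d \<in> edge_event (xs ! i) (xs ! Suc i)}"
    using len by (simp add: hook_event_def xs_def[symmetric] N_def lessThan_def)
  have "disjoint_family_on (\<lambda>i. edge_event (xs ! i) (xs ! Suc i)) {..<N}"
    using h disjoint_family_on_hooked unfolding hooked_tuples_def xs_def N_def by blast
  from prob_hit_disjoint_events_le[OF _ this, of m D]
  have "measure_pmf.prob (replicate_pmf m D) (hook_event h)
      \<le> real m ^ N * (\<Prod>i<N. measure_pmf.prob D (edge_event (xs ! i) (xs ! Suc i)))"
    unfolding ev by simp
  also have "\<dots> = (\<Prod>i<N. w (xs ! i) (xs ! Suc i))"
    by (simp add: w prod.distrib)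
  also have "\<dots> = walk_weight w (hd xs) (tl xs)"
    using walk_weight_nth[where vs = "tl xs" and u = "hd xs" and w = w] len xs by (simp add: N_def)
  finally show ?thesis unfolding xs_def .
qed

text \<open>The steps into \<open>neg y\<close> and into z have prescribed targets and cost \<kappa>
  each; the other steps form two free walks, summed by the supersolution. With \<open>card L\<close>
  linear in n and \<kappa> of order 1/n, this is where the total becomes O(1/n).\<close>

lemma sum_hook_weight_le:
  fixes \<rho> R \<kappa> :: real
  assumes finL: "finite L" and negL: "neg ` L \<subseteq> L"
    and nonneg: "\<And>u v. 0 \<le> w u v" and \<rho>: "0 \<le> \<rho>"
    and row: "\<And>u. u \<in> L \<Longrightarrow> (\<Sum>v\<in>L. w u v * x v) \<le> \<rho> * x u"
    and x: "\<And>u. u \<in> L \<Longrightarrow> 1 \<le> x u" "\<And>u. u \<in> L \<Longrightarrow> x u \<le> R"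
    and \<kappa>: "\<And>u v. u \<in> L \<Longrightarrow> v \<in> L \<Longrightarrow> w u v \<le> \<kappa>" "0 \<le> \<kappa>"
  shows "(\<Sum>h\<in>hooks L a b. walk_weight w (hd (hook_list h)) (tl (hook_list h)))
    \<le> real (card L) * 2 * \<kappa>\<^sup>2 * R\<^sup>2 * (real (Suc a) * \<rho> ^ a) * (real (Suc b) * \<rho> ^ b)"
proof -
  define Z where "Z = (\<lambda>(y :: literal) ws zs. {z \<in> L. fst z \<in> fst ` set (y # ws @ zs)})"
  define c where "c = 2 * real (Suc a) * real (Suc b)"
  have R: "0 \<le> R" if "u \<in> L" for u using x[OF that] by linarith
  have cardZ: "real (card (Z y ws zs)) \<le> c" if "length ws = a" "length zs = b" for y :: literal and ws zs
  proof -
    have "Z y ws zs \<subseteq> fst ` set (y # ws @ zs) \<times> UNIV"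
      by (rule subsetI) (simp only: Z_def mem_Collect_eq mem_Times_iff UNIV_I simp_thms)
    then have "card (Z y ws zs) \<le> card (fst ` set (y # ws @ zs) \<times> (UNIV :: bool set))"
      by (intro card_mono) auto
    also have "\<dots> = 2 * card (fst ` set (y # ws @ zs))" by (simp add: card_cartesian_product)
    also have "card (fst ` set (y # ws @ zs)) \<le> length (y # ws @ zs)"
      by (rule order_trans[OF card_image_le card_length]) simp
    also have "\<dots> = Suc (a + b)" using that by simp
    \<comment> \<open>Generous, but it makes the later double sum over a and b a product.\<close>
    also have "Suc (a + b) \<le> Suc a * Suc b" by simp
    finally have "card (Z y ws zs) \<le> 2 * (Suc a * Suc b)" by simp
    then show ?thesis unfolding c_def by (metis (mono_tags, opaque_lifting) mult.assoc of_nat_le_iff of_nat_mult of_nat_numeral)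
  qed
  have inner: "(\<Sum>z\<in>Z y ws zs. walk_weight w y (ws @ neg y # zs @ [z]))
      \<le> c * \<kappa>\<^sup>2 * (walk_weight w y ws * walk_weight w (neg y) zs)"
    if y: "y \<in> L" and ws: "ws \<in> lists_over L a" and zs: "zs \<in> lists_over L b" for y ws zs
  proof -
    define W where "W = walk_weight w y ws * walk_weight w (neg y) zs"
    have W: "0 \<le> W" unfolding W_def by (intro mult_nonneg_nonneg walk_weight_nonneg nonneg)
    have ny: "neg y \<in> L" using y negL by blast
    have lastL: "last (y # ws) \<in> L" "last (neg y # zs) \<in> L"
      using y ny ws zs last_in_set[of "y # ws"] last_in_set[of "neg y # zs"]
      by (auto simp: lists_over_def)
    have "walk_weight w y (ws @ neg y # zs @ [z]) \<le> \<kappa>\<^sup>2 * W" if "z \<in> L" for z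
    proof -
      have "walk_weight w y (ws @ neg y # zs @ [z])
          = (w (last (y # ws)) (neg y) * w (last (neg y # zs)) z) * W"
        unfolding W_def walk_weight_append walk_weight.simps by (simp add: mult_ac)
      also have "\<dots> \<le> (\<kappa> * \<kappa>) * W"
        using lastL ny that by (intro mult_right_mono mult_mono \<kappa> nonneg W) auto
      finally show ?thesis by (simp add: power2_eq_square)
    qed
    then have "(\<Sum>z\<in>Z y ws zs. walk_weight w y (ws @ neg y # zs @ [z])) \<le> real (card (Z y ws zs)) * (\<kappa>\<^sup>2 * W)"
      by (intro sum_bounded_above) (auto simp: Z_def)
    also have "\<dots> \<le> c * (\<kappa>\<^sup>2 * W)"
      using ws zs W by (intro mult_right_mono cardZ) (auto simp: lists_over_def)
    finally show ?thesis by (simp add: W_def mult_ac)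
  qed
  have Wy: "(\<Sum>ws\<in>lists_over L n. walk_weight w y ws) \<le> \<rho> ^ n * R" if "y \<in> L" for y n
  proof -
    have "(\<Sum>ws\<in>lists_over L n. walk_weight w y ws) \<le> \<rho> ^ n * x y"
      by (rule sum_walk_weight_le) (use assms that in auto)
    also have "\<dots> \<le> \<rho> ^ n * R" using \<rho> x that by (intro mult_left_mono) auto
    finally show ?thesis .
  qed
  have fin: "finite (lists_over L n)" for n using finL by (rule finite_lists_over)
  have finZ: "finite (Z y ws zs)" for y ws zs using finL by (simp add: Z_def)
  have hooks_eq: "hooks L a b =
      (SIGMA y:L. SIGMA ws:lists_over L a. SIGMA zs:lists_over L b. Z y ws zs)"
    by (simp only: hooks_def Z_def)
  have "(\<Sum>h\<in>hooks L a b. walk_weight w (hd (hook_list h)) (tl (hook_list h)))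
      = (\<Sum>y\<in>L. \<Sum>ws\<in>lists_over L a. \<Sum>zs\<in>lists_over L b. \<Sum>z\<in>Z y ws zs.
          walk_weight w y (ws @ neg y # zs @ [z]))"
    unfolding hooks_eq
    by (simp add: sum.Sigma finL fin finZ hook_list_def case_prod_beta)
  also have "\<dots> \<le> (\<Sum>y\<in>L. \<Sum>ws\<in>lists_over L a. \<Sum>zs\<in>lists_over L b.
      c * \<kappa>\<^sup>2 * (walk_weight w y ws * walk_weight w (neg y) zs))"
    by (intro sum_mono inner)
  also have "\<dots> = (\<Sum>y\<in>L. c * \<kappa>\<^sup>2 * ((\<Sum>ws\<in>lists_over L a. walk_weight w y ws)
      * (\<Sum>zs\<in>lists_over L b. walk_weight w (neg y) zs)))"
    by (simp only: sum_product) (simp only: sum_distrib_left)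
  also have "\<dots> \<le> (\<Sum>y\<in>L. c * \<kappa>\<^sup>2 * ((\<rho> ^ a * R) * (\<rho> ^ b * R)))"
    using negL \<rho> R by (intro sum_mono mult_left_mono mult_mono Wy sum_nonneg walk_weight_nonneg nonneg)
      (auto simp: c_def)
  also have "\<dots> = real (card L) * 2 * \<kappa>\<^sup>2 * R\<^sup>2 * (real (Suc a) * \<rho> ^ a) * (real (Suc b) * \<rho> ^ b)"
    by (simp add: c_def power2_eq_square mult_ac)
  finally show ?thesis .
qed

lemma prob_not_sat2_le:
  fixes D :: "(literal \<times> literal) pmf" and m :: nat and \<rho> R \<kappa> :: real
  defines "w \<equiv> (\<lambda>u v. real m * measure_pmf.prob D (edge_event u v))"
  assumes finL: "finite L" and negL: "neg ` L \<subseteq> L"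
    and D: "set_pmf D \<subseteq> {(u, v). u \<in> L \<and> v \<in> L \<and> fst u \<noteq> fst v}"
    and \<rho>: "0 \<le> \<rho>" "\<rho> < 1"
    and row: "\<And>u. u \<in> L \<Longrightarrow> (\<Sum>v\<in>L. w u v * x v) \<le> \<rho> * x u"
    and x: "\<And>u. u \<in> L \<Longrightarrow> 1 \<le> x u" "\<And>u. u \<in> L \<Longrightarrow> x u \<le> R"
    and \<kappa>: "\<And>u v. u \<in> L \<Longrightarrow> v \<in> L \<Longrightarrow> w u v \<le> \<kappa>" "0 \<le> \<kappa>"
  shows "measure_pmf.prob (replicate_pmf m D) {\<omega>. \<not> sat2 (set \<omega>)}
    \<le> real (card L) * 2 * \<kappa>\<^sup>2 * R\<^sup>2 / (1 - \<rho>) ^ 4"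
proof -
  define M where "M = replicate_pmf m D"
  define n where "n = card L"
  define C where "C = real n * 2 * \<kappa>\<^sup>2 * R\<^sup>2"
  have w0: "0 \<le> w u v" for u v by (simp add: w_def)
  have C0: "0 \<le> C" by (simp add: C_def)
  have finH: "finite (hooked_tuples L a b)" for a b
    using finite_hooks[OF finL] by (simp add: hooked_tuples_def)
  have ab: "measure_pmf.prob M (\<Union>h\<in>hooked_tuples L a b. hook_event h)
      \<le> C * (real (Suc a) * \<rho> ^ a) * (real (Suc b) * \<rho> ^ b)" for a b
  proof -
    have "measure_pmf.prob M (\<Union>h\<in>hooked_tuples L a b. hook_event h)
        \<le> (\<Sum>h\<in>hooked_tuples L a b. measure_pmf.prob M (hook_event h))"
      using finH by (intro measure_pmf.finite_measure_subadditive_finite) auto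
    also have "\<dots> \<le> (\<Sum>h\<in>hooked_tuples L a b. walk_weight w (hd (hook_list h)) (tl (hook_list h)))"
      unfolding M_def by (intro sum_mono prob_hook_event_le) (auto simp: w_def)
    also have "\<dots> \<le> (\<Sum>h\<in>hooks L a b. walk_weight w (hd (hook_list h)) (tl (hook_list h)))"
      using finite_hooks[OF finL] w0
      by (intro sum_mono2 walk_weight_nonneg) (auto simp: hooked_tuples_def)
    also have "\<dots> \<le> C * (real (Suc a) * \<rho> ^ a) * (real (Suc b) * \<rho> ^ b)"
      unfolding C_def n_def
      by (rule sum_hook_weight_le[where x = x]) (use assms w0 in auto)
    finally show ?thesis .
  qed
  have "measure_pmf.prob M {\<omega>. \<not> sat2 (set \<omega>)} = measure_pmf.prob M ({\<omega>. \<not> sat2 (set \<omega>)} \<inter> set_pmf M)"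
    by (simp add: measure_Int_set_pmf)
  also have "\<dots> \<le> measure_pmf.prob M (\<Union>a<n. \<Union>b<n. \<Union>h\<in>hooked_tuples L a b. hook_event h)"
  proof (rule measure_pmf.finite_measure_mono)
    show "{\<omega>. \<not> sat2 (set \<omega>)} \<inter> set_pmf M \<subseteq> (\<Union>a<n. \<Union>b<n. \<Union>h\<in>hooked_tuples L a b. hook_event h)"
    proof
      fix \<omega> assume \<omega>: "\<omega> \<in> {\<omega>. \<not> sat2 (set \<omega>)} \<inter> set_pmf M"
      then have "set \<omega> \<subseteq> set_pmf D" by (auto simp: M_def set_replicate_pmf)
      then have "\<exists>a<n. \<exists>b<n. \<exists>h\<in>hooked_tuples L a b. \<omega> \<in> hook_event h"
        using unsat_in_hook_events[OF finL negL subset_trans[OF _ D], of \<omega>] \<omega> unfolding n_def by simp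
      then show "\<omega> \<in> (\<Union>a<n. \<Union>b<n. \<Union>h\<in>hooked_tuples L a b. hook_event h)" by blast
    qed
  qed simp
  also have "\<dots> \<le> (\<Sum>a<n. measure_pmf.prob M (\<Union>b<n. \<Union>h\<in>hooked_tuples L a b. hook_event h))"
    by (intro measure_pmf.finite_measure_subadditive_finite) auto
  also have "\<dots> \<le> (\<Sum>a<n. \<Sum>b<n. measure_pmf.prob M (\<Union>h\<in>hooked_tuples L a b. hook_event h))"
    by (intro sum_mono measure_pmf.finite_measure_subadditive_finite) auto
  also have "\<dots> \<le> (\<Sum>a<n. \<Sum>b<n. C * (real (Suc a) * \<rho> ^ a) * (real (Suc b) * \<rho> ^ b))"
    by (intro sum_mono ab)
  also have "\<dots> = C * ((\<Sum>a<n. real (Suc a) * \<rho> ^ a) * (\<Sum>b<n. real (Suc b) * \<rho> ^ b))"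
    by (simp only: sum_product) (simp only: sum_distrib_left mult.assoc)
  also have "\<dots> \<le> C * (1 / (1 - \<rho>)\<^sup>2 * (1 / (1 - \<rho>)\<^sup>2))"
    by (intro mult_left_mono mult_mono sum_Suc_power_le C0 \<rho> sum_nonneg) (use \<rho> in auto)
  also have "\<dots> = C / (1 - \<rho>) ^ 4" by (simp add: power4_eq_xxxx power2_eq_square)
  finally show ?thesis unfolding M_def C_def n_def .
qed

section \<open>Types and weights of literals\<close>

text \<open>The weights were found numerically: for \<open>k = 5\<close> their \<open>k\<close>-th powers approximate
  the Perron eigenvector of the matrix of expected implications, with the strategy itself
  depending on the weights.\<close>

definition weight :: "nat \<Rightarrow> int" where
  "weight a = [7, 13, 20, 26, 32, 37, 43, 49] ! a"

text \<open>The order of the types is the order of the weights, and negation is \<open>a \<mapsto> 7 - a\<close>.\<close>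

definition lit_type :: "literal \<Rightarrow> nat" where
  "lit_type l = (if snd l then fst l mod 4 else 7 - fst l mod 4)"

lemma lit_type_less: "lit_type l < 8"
proof -
  have "fst l mod 4 < 4" by simp
  then show ?thesis unfolding lit_type_def by (auto intro: less_trans)
qed

lemma lit_type_neg: "lit_type (neg l) = 7 - lit_type l"
proof -
  have "fst l mod 4 < 4" by simp
  then show ?thesis unfolding lit_type_def neg_def by auto
qed

lemma less_8_cases:
  fixes a :: nat
  assumes "a < 8"
  obtains "a = 0" | "a = 1" | "a = 2" | "a = 3" | "a = 4" | "a = 5" | "a = 6" | "a = 7"
  using assms by linarith

lemma weight_simps [simp]:
  "weight 0 = 7" "weight (Suc 0) = 13" "weight 2 = 20" "weight 3 = 26" "weight 4 = 32" "weight 5 = 37"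
  "weight 6 = 43" "weight 7 = 49"
  by (simp_all add: weight_def)

lemma weight_bounds: "a < 8 \<Longrightarrow> 7 \<le> weight a" "a < 8 \<Longrightarrow> weight a \<le> 49"
  by (erule less_8_cases; simp)+

lemma weight_mono: "a \<le> b \<Longrightarrow> b < 8 \<Longrightarrow> weight a \<le> weight b"
proof -
  assume "a \<le> b" "b < 8"
  moreover from this have "a < 8" by simp
  ultimately show ?thesis by (elim less_8_cases) simp_all
qed

text \<open>The minimum over pairs depends on the clause as a set only, with no choice among
  literals of equal type; for k \<ge> 2 it is the product of the two smallest weights.\<close>

definition cost :: "clause \<Rightarrow> int" where
  "cost C = Min {weight (lit_type u) * weight (lit_type v) | u v. u \<in> C \<and> v \<in> C \<and> u \<noteq> v}"

definition lightest :: "nat list \<Rightarrow> nat \<Rightarrow> nat \<Rightarrow> bool" where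
  "lightest \<tau> i j \<longleftrightarrow> i < length \<tau> \<and> j < length \<tau> \<and> i \<noteq> j \<and> \<tau> ! i \<le> \<tau> ! j \<and>
     (\<forall>p<length \<tau>. p \<noteq> i \<longrightarrow> \<tau> ! j \<le> \<tau> ! p)"

text \<open>Ties are resolved by an arbitrary choice that sees only the types. Lists of literals
  with the same type list thus have their light pair at the same positions, which the counting below
  relies on.\<close>

definition lightest_pos :: "nat list \<Rightarrow> nat \<times> nat" where
  "lightest_pos \<tau> = (SOME (i, j). lightest \<tau> i j)"

lemma ex_lightest:
  assumes "2 \<le> length \<tau>"
  shows "\<exists>i j. lightest \<tau> i j"
proof -
  define i where "i = arg_min_on ((!) \<tau>) {..<length \<tau>}"
  define j where "j = arg_min_on ((!) \<tau>) ({..<length \<tau>} - {i})"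
  have ne0: "{..<length \<tau>} \<noteq> {}" using assms by (cases \<tau>) auto
  have i: "i < length \<tau>" "\<And>p. p < length \<tau> \<Longrightarrow> \<tau> ! i \<le> \<tau> ! p"
    using arg_min_if_finite(1)[of "{..<length \<tau>}" "(!) \<tau>"] arg_min_least[of "{..<length \<tau>}" _ "(!) \<tau>"] ne0
    by (auto simp: i_def)
  have "card ({..<length \<tau>} - {i}) \<noteq> 0" using i assms by simp
  then have ne: "{..<length \<tau>} - {i} \<noteq> {}" by force
  have j: "j \<in> {..<length \<tau>} - {i}" "\<And>p. p \<in> {..<length \<tau>} - {i} \<Longrightarrow> \<tau> ! j \<le> \<tau> ! p"
    using arg_min_if_finite(1)[of "{..<length \<tau>} - {i}" "(!) \<tau>"]
      arg_min_least[of "{..<length \<tau>} - {i}" _ "(!) \<tau>"] ne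
    unfolding j_def by blast+
  have "lightest \<tau> i j" unfolding lightest_def using i j by auto
  then show ?thesis by blast
qed

lemma lightest_lightest_pos:
  assumes "2 \<le> length \<tau>" "lightest_pos \<tau> = (i, j)"
  shows "lightest \<tau> i j"
  using someI_ex[of "\<lambda>(i, j). lightest \<tau> i j"] ex_lightest[OF assms(1)] assms(2)
  unfolding lightest_pos_def by auto

definition low :: "nat list \<Rightarrow> nat \<times> nat" where
  "low \<tau> = (case lightest_pos \<tau> of (i, j) \<Rightarrow> (\<tau> ! i, \<tau> ! j))"

definition light_pair :: "literal list \<Rightarrow> literal \<times> literal" where
  "light_pair \<omega> = (case lightest_pos (map lit_type \<omega>) of (i, j) \<Rightarrow> (\<omega> ! i, \<omega> ! j))"

definition pair_weight :: "nat \<times> nat \<Rightarrow> int" where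
  "pair_weight = (\<lambda>(a, b). weight a * weight b)"

lemma lightest_posE:
  assumes "2 \<le> length \<tau>"
  obtains i j where "lightest_pos \<tau> = (i, j)" "i < length \<tau>" "j < length \<tau>" "i \<noteq> j"
    "\<tau> ! i \<le> \<tau> ! j" "\<And>p. p < length \<tau> \<Longrightarrow> p \<noteq> i \<Longrightarrow> \<tau> ! j \<le> \<tau> ! p"
  using lightest_lightest_pos[OF assms] unfolding lightest_def by (cases "lightest_pos \<tau>") blast

lemma low_light_pair:
  assumes "2 \<le> length \<omega>"
  shows "low (map lit_type \<omega>) = map_prod lit_type lit_type (light_pair \<omega>)"
proof -
  obtain i j where "lightest_pos (map lit_type \<omega>) = (i, j)" "i < length \<omega>" "j < length \<omega>"
    using lightest_posE[of "map lit_type \<omega>"] assms by (metis length_map)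
  then show ?thesis by (simp add: low_def light_pair_def)
qed

lemma light_pair_in:
  assumes "2 \<le> length \<omega>" "distinct \<omega>" "light_pair \<omega> = (u, v)"
  shows "u \<in> set \<omega>" "v \<in> set \<omega>" "u \<noteq> v"
proof -
  obtain i j where "lightest_pos (map lit_type \<omega>) = (i, j)" "i < length \<omega>" "j < length \<omega>" "i \<noteq> j"
    using lightest_posE[of "map lit_type \<omega>"] assms(1) by (metis length_map)
  then show "u \<in> set \<omega>" "v \<in> set \<omega>" "u \<noteq> v"
    using assms(2,3) by (auto simp: light_pair_def nth_eq_iff_index_eq)
qed

text \<open>Of two distinct positions at least one differs from i and is therefore at least as heavy
  as j, while the other is at least as heavy as i.\<close>

lemma cost_set:
  assumes "2 \<le> length \<omega>" "distinct \<omega>"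
  shows "cost (set \<omega>) = pair_weight (low (map lit_type \<omega>))"
proof -
  define \<tau> where "\<tau> = map lit_type \<omega>"
  have len: "length \<tau> = length \<omega>" by (simp add: \<tau>_def)
  have less: "\<tau> ! p < 8" if "p < length \<omega>" for p using that lit_type_less by (simp add: \<tau>_def)
  obtain i j where ij: "lightest_pos \<tau> = (i, j)" "i < length \<omega>" "j < length \<omega>" "i \<noteq> j"
    "\<tau> ! i \<le> \<tau> ! j" and le: "\<And>p. p < length \<omega> \<Longrightarrow> p \<noteq> i \<Longrightarrow> \<tau> ! j \<le> \<tau> ! p"
    using lightest_posE[of \<tau>] assms(1) unfolding len by metis
  define S where "S = {weight (lit_type u) * weight (lit_type v) | u v. u \<in> set \<omega> \<and> v \<in> set \<omega> \<and> u \<noteq> v}"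
  have pos: "0 \<le> weight a" if "a < 8" for a using weight_bounds(1)[OF that] by simp
  have "Min S = weight (\<tau> ! i) * weight (\<tau> ! j)"
  proof (rule Min_eqI)
    have "S \<subseteq> (\<lambda>(u, v). weight (lit_type u) * weight (lit_type v)) ` (set \<omega> \<times> set \<omega>)"
      by (auto simp: S_def)
    then show "finite S" by (rule finite_subset) auto
  next
    fix y assume "y \<in> S"
    then obtain u v where uv: "u \<in> set \<omega>" "v \<in> set \<omega>" "u \<noteq> v"
      and y: "y = weight (lit_type u) * weight (lit_type v)" unfolding S_def by blast
    then obtain p q where pq: "p < length \<omega>" "q < length \<omega>" "p \<noteq> q" "\<omega> ! p = u" "\<omega> ! q = v"
      by (metis in_set_conv_nth)
    have y': "y = weight (\<tau> ! p) * weight (\<tau> ! q)" using y pq by (simp add: \<tau>_def)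
    have *: "weight (\<tau> ! i) * weight (\<tau> ! j) \<le> weight (\<tau> ! p) * weight (\<tau> ! q)"
      if "p < length \<omega>" "q < length \<omega>" "q \<noteq> i" for p q
    proof -
      have "\<tau> ! i \<le> \<tau> ! p" using le[of p] ij(5) that by (cases "p = i") auto
      then show ?thesis
        using le[of q] that less ij(2,3) by (intro mult_mono weight_mono pos) auto
    qed
    show "weight (\<tau> ! i) * weight (\<tau> ! j) \<le> y"
      using *[of p q] *[of q p] pq y' by (cases "q = i") (auto simp: mult.commute)
  next
    show "weight (\<tau> ! i) * weight (\<tau> ! j) \<in> S"
      unfolding S_def using ij(2-4) assms(2)
      by (intro CollectI exI[of _ "\<omega> ! i"] exI[of _ "\<omega> ! j"]) (auto simp: \<tau>_def nth_eq_iff_index_eq)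
  qed
  then show ?thesis unfolding cost_def S_def[symmetric] \<tau>_def[symmetric]
    by (simp add: low_def ij(1) pair_weight_def)
qed

section \<open>Counting type lists by their two smallest entries\<close>

definition boxes :: "nat \<Rightarrow> (nat \<Rightarrow> 'a set) \<Rightarrow> 'a list set" where
  "boxes k B = {xs. length xs = k \<and> (\<forall>p<k. xs ! p \<in> B p)}"

lemma card_boxes: "card (boxes k B) = (\<Prod>p<k. card (B p))"
proof (induction k arbitrary: B)
  case 0
  have "boxes 0 B = {[]}" by (auto simp: boxes_def)
  then show ?case by simp
next
  case (Suc k)
  have "boxes (Suc k) B = (\<lambda>(x, xs). x # xs) ` (B 0 \<times> boxes k (\<lambda>p. B (Suc p)))"
  proof (intro equalityI subsetI)
    fix xs assume xs: "xs \<in> boxes (Suc k) B"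
    then obtain y ys where "xs = y # ys" by (cases xs) (auto simp: boxes_def)
    with xs show "xs \<in> (\<lambda>(x, xs). x # xs) ` (B 0 \<times> boxes k (\<lambda>p. B (Suc p)))"
      by (force simp: boxes_def)
  next
    fix xs assume "xs \<in> (\<lambda>(x, xs). x # xs) ` (B 0 \<times> boxes k (\<lambda>p. B (Suc p)))"
    then show "xs \<in> boxes (Suc k) B"
      by (auto simp: boxes_def less_Suc_eq_0_disj)
  qed
  then have "card (boxes (Suc k) B) = card (B 0 \<times> boxes k (\<lambda>p. B (Suc p)))"
    by (simp add: card_image inj_on_def)
  then show ?case using Suc by (simp add: card_cartesian_product prod.lessThan_Suc_shift del: prod.lessThan_Suc)
qed

lemma finite_boxes:
  assumes "\<And>p. p < k \<Longrightarrow> finite (B p)"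
  shows "finite (boxes k B)"
proof (rule finite_subset)
  show "boxes k B \<subseteq> {xs. set xs \<subseteq> (\<Union>p<k. B p) \<and> length xs = k}"
    by (auto simp: boxes_def in_set_conv_nth) (metis lessThan_iff)
qed (rule finite_lists_length_eq, use assms in auto)

lemma prod_if_single:
  fixes x y :: nat
  assumes "i < k"
  shows "(\<Prod>p<k. if p = i then x else y) = x * y ^ (k - 1)"
  using assms by (subst prod.remove[of _ i]) (auto simp: prod_constant)

text \<open>Types are treated as uniformly distributed on \<open>{..<8}\<close>; \<open>low_count k a b\<close> is the number of
  type lists of length \<open>k\<close> whose two smallest entries are \<open>a \<le> b\<close>. Integers avoid truncated
  subtraction.\<close>

definition low_count :: "nat \<Rightarrow> nat \<Rightarrow> nat \<Rightarrow> int" where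
  "low_count k a b =
    (if a < b then int k * ((8 - int b) ^ (k - 1) - (7 - int b) ^ (k - 1))
     else if a = b then (8 - int a) ^ k - (7 - int a) ^ k - int k * (7 - int a) ^ (k - 1)
     else 0)"

text \<open>If a < b, the entry a sits at one of k positions and the other entries are all at least
  b, but not all greater than b. If a = b, the lists without an a and those with exactly one a are
  removed from the lists with entries at least a.\<close>

lemma card_low_le:
  assumes k: "2 \<le> k" and ab: "a < 8" "b < 8"
  shows "int (card {\<tau> \<in> lists_over {..<8} k. low \<tau> = (a, b)}) \<le> low_count k a b"
proof -
  define T where "T = {\<tau> \<in> lists_over {..<8::nat} k. low \<tau> = (a, b)}"
  define S where "S = (\<lambda>i c. boxes k (\<lambda>p. if p = i then {a} else {c..<8}))"
  define V where "V = (\<lambda>c. boxes k (\<lambda>p. {c..<8::nat}))"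
  have finS: "finite (S i c)" and finV: "finite (V c)" for i c
    unfolding S_def V_def by (auto intro!: finite_boxes)
  have cardS: "card (S i c) = (8 - c) ^ (k - 1)" if "i < k" for i c
  proof -
    have "card (S i c) = (\<Prod>p<k. if p = i then 1 else 8 - c)"
      unfolding S_def card_boxes by (rule prod.cong) auto
    then show ?thesis using that by (simp add: prod_if_single)
  qed
  have cardV: "card (V c) = (8 - c) ^ k" for c
    unfolding V_def card_boxes by simp
  have T: "\<exists>i<k. \<exists>j<k. i \<noteq> j \<and> a \<le> b \<and> \<tau> ! i = a \<and> \<tau> ! j = b \<and> (\<forall>p<k. p \<noteq> i \<longrightarrow> \<tau> ! p \<in> {b..<8}) \<and> length \<tau> = k"
    if "\<tau> \<in> T" for \<tau>
  proof -
    have len: "length \<tau> = k" and less: "\<And>p. p < k \<Longrightarrow> \<tau> ! p < 8" and low: "low \<tau> = (a, b)"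
      using that nth_mem unfolding T_def lists_over_def by blast+
    obtain i j where ij: "lightest_pos \<tau> = (i, j)" "i < k" "j < k" "i \<noteq> j" "\<tau> ! i \<le> \<tau> ! j"
      "\<And>p. p < k \<Longrightarrow> p \<noteq> i \<Longrightarrow> \<tau> ! j \<le> \<tau> ! p"
      using lightest_posE[of \<tau>] k unfolding len by metis
    then show ?thesis using low len less by (intro exI[of _ i] exI[of _ j] conjI) (auto simp: low_def)
  qed
  consider "a < b" | "a = b" | "b < a" by linarith
  then have "int (card T) \<le> low_count k a b"
  proof cases
    case 1
    have sub: "S i (Suc b) \<subseteq> S i b" for i
      unfolding S_def boxes_def by fastforce
    have "T \<subseteq> (\<Union>i<k. S i b - S i (Suc b))"
    proof
      fix \<tau> assume "\<tau> \<in> T"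
      from T[OF this] obtain i j where ij: "i < k" "j < k" "i \<noteq> j" "\<tau> ! i = a" "\<tau> ! j = b"
        "\<forall>p<k. p \<noteq> i \<longrightarrow> \<tau> ! p \<in> {b..<8}" "length \<tau> = k" by blast
      have "\<tau> \<in> S i b" using ij unfolding S_def boxes_def by simp
      moreover have "\<tau> \<notin> S i (Suc b)" using ij unfolding S_def boxes_def by force
      ultimately show "\<tau> \<in> (\<Union>i<k. S i b - S i (Suc b))" using ij by blast
    qed
    then have "card T \<le> card (\<Union>i<k. S i b - S i (Suc b))"
      using finS by (intro card_mono) auto
    also have "\<dots> \<le> (\<Sum>i<k. card (S i b - S i (Suc b)))"
      by (rule card_UN_le) simp
    finally have "int (card T) \<le> (\<Sum>i<k. int (card (S i b - S i (Suc b))))"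
      by (metis of_nat_le_iff of_nat_sum)
    also have "\<dots> = (\<Sum>i<k. (8 - int b) ^ (k - 1) - (7 - int b) ^ (k - 1))"
    proof (rule sum.cong)
      fix i assume "i \<in> {..<k}"
      then have i: "i < k" by simp
      have "int (card (S i b - S i (Suc b))) = int (card (S i b)) - int (card (S i (Suc b)))"
        using sub[of i] finS card_mono[OF finS sub] by (simp add: card_Diff_subset of_nat_diff)
      then show "int (card (S i b - S i (Suc b))) = (8 - int b) ^ (k - 1) - (7 - int b) ^ (k - 1)"
        using ab i by (simp add: cardS of_nat_diff)
    qed simp
    also have "\<dots> = low_count k a b" using 1 by (simp add: low_count_def)
    finally show ?thesis .
  next
    case 2
    define U where "U = (\<Union>i<k. S i (Suc a))"
    have "T \<subseteq> V a - (V (Suc a) \<union> U)"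
    proof
      fix \<tau> assume "\<tau> \<in> T"
      from T[OF this] obtain i j where ij: "i < k" "j < k" "i \<noteq> j" "\<tau> ! i = a" "\<tau> ! j = a"
        "\<forall>p<k. p \<noteq> i \<longrightarrow> \<tau> ! p \<in> {a..<8}" "length \<tau> = k" using 2 by blast
      have "\<tau> \<in> V a" using ij ab unfolding V_def boxes_def by force
      moreover have "\<tau> \<notin> V (Suc a)" using ij unfolding V_def boxes_def by force
      moreover have "\<tau> \<notin> S p (Suc a)" if "p < k" for p
        using ij unfolding S_def boxes_def by (cases "p = i") force+
      ultimately show "\<tau> \<in> V a - (V (Suc a) \<union> U)" unfolding U_def by blast
    qed
    then have "card T \<le> card (V a - (V (Suc a) \<union> U))"
      using finV by (intro card_mono) auto
    moreover have finU: "finite U" using finS unfolding U_def by auto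
    moreover have sub: "V (Suc a) \<union> U \<subseteq> V a"
      using ab unfolding V_def U_def S_def boxes_def by (auto split: if_splits)
    moreover have "V (Suc a) \<inter> U = {}"
      unfolding V_def U_def S_def boxes_def by force
    moreover have "card U = (\<Sum>i<k. card (S i (Suc a)))"
      unfolding U_def
    proof (rule card_UN_disjoint)
      show "\<forall>i\<in>{..<k}. \<forall>j\<in>{..<k}. i \<noteq> j \<longrightarrow> S i (Suc a) \<inter> S j (Suc a) = {}"
        unfolding S_def boxes_def by force
    qed (use finS in auto)
    ultimately have cT: "card T \<le> card (V a) - (card (V (Suc a)) + card U)"
      and cV: "card (V (Suc a)) + card U \<le> card (V a)"
      and cU: "card U = (\<Sum>i<k. card (S i (Suc a)))"
      using finV card_mono[OF finV sub] by (simp_all add: card_Diff_subset card_Un_disjoint)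
    from cT cV have "int (card T) \<le> int (card (V a)) - (int (card (V (Suc a))) + int (card U))"
      by linarith
    then show ?thesis using 2 ab unfolding cU by (simp add: cardS cardV low_count_def of_nat_diff)
  next
    case 3
    then have "T = {}" using T by force
    then show ?thesis using 3 by (simp add: low_count_def)
  qed
  then show ?thesis by (simp add: T_def)
qed

lemma card_low_Collect_le:
  assumes k: "2 \<le> k"
  shows "int (card {\<tau> \<in> lists_over {..<8} k. P (low \<tau>)})
    \<le> (\<Sum>c<8. \<Sum>d<8. if P (c, d) then low_count k c d else 0)"
proof -
  define T where "T = (\<lambda>cd. {\<tau> \<in> lists_over {..<8::nat} k. low \<tau> = cd})"
  have finT: "finite (T cd)" for cd
    unfolding T_def by (simp add: finite_lists_over)
  have "low \<tau> \<in> {..<8} \<times> {..<8}" if "\<tau> \<in> lists_over {..<8} k" for \<tau>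
  proof -
    have len: "length \<tau> = k" and less: "\<And>p. p < k \<Longrightarrow> \<tau> ! p < 8"
      using that nth_mem unfolding lists_over_def by blast+
    obtain i j where "lightest_pos \<tau> = (i, j)" "i < k" "j < k"
      using lightest_posE[of \<tau>] k unfolding len by metis
    then show ?thesis using less unfolding low_def by simp
  qed
  then have "{\<tau> \<in> lists_over {..<8} k. P (low \<tau>)} \<subseteq> (\<Union>cd\<in>{cd \<in> {..<8} \<times> {..<8}. P cd}. T cd)"
    unfolding T_def by blast
  then have "card {\<tau> \<in> lists_over {..<8} k. P (low \<tau>)} \<le> card (\<Union>cd\<in>{cd \<in> {..<8} \<times> {..<8}. P cd}. T cd)"
    using finT by (intro card_mono) auto
  also have "\<dots> \<le> (\<Sum>cd\<in>{cd \<in> {..<8} \<times> {..<8}. P cd}. card (T cd))"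
    by (rule card_UN_le) simp
  finally have "card {\<tau> \<in> lists_over {..<8} k. P (low \<tau>)}
      \<le> (\<Sum>cd\<in>{cd \<in> {..<8} \<times> {..<8}. P cd}. card (T cd))" .
  then have "int (card {\<tau> \<in> lists_over {..<8} k. P (low \<tau>)})
      \<le> (\<Sum>cd\<in>{cd \<in> {..<8} \<times> {..<8}. P cd}. int (card (T cd)))"
    unfolding of_nat_sum[symmetric] by (rule of_nat_mono)
  also have "\<dots> = (\<Sum>cd\<in>{..<8} \<times> {..<8}. if P cd then int (card (T cd)) else 0)"
    by (rule sum.inter_filter) simp
  also have "\<dots> = (\<Sum>c<8. \<Sum>d<8. if P (c, d) then int (card (T (c, d))) else 0)"
    by (simp add: sum.cartesian_product)
  also have "\<dots> \<le> (\<Sum>c<8. \<Sum>d<8. if P (c, d) then low_count k c d else 0)"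
    using card_low_le[OF k] by (intro sum_mono) (auto simp: T_def)
  finally show ?thesis .
qed

section \<open>The distribution of the selected 2-clause\<close>

definition lits :: "nat \<Rightarrow> literal set" where
  "lits n = {1..n} \<times> UNIV"

lemma finite_lits [simp]: "finite (lits n)"
  by (simp add: lits_def)

lemma card_lits: "card (lits n) = 2 * n"
  by (simp add: lits_def card_cartesian_product)

text \<open>The type reveals the sign and the residue modulo 4, so the quotient by 4 determines the
  literal.\<close>

lemma card_lits_type_le: "card {l \<in> lits n. lit_type l = a} \<le> n div 4 + 1"
proof -
  have "inj_on (\<lambda>l. fst l div 4) {l \<in> lits n. lit_type l = a}"
  proof (rule inj_onI)
    fix l l' assume *: "l \<in> {l \<in> lits n. lit_type l = a}" "l' \<in> {l \<in> lits n. lit_type l = a}"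
      "fst l div 4 = fst l' div 4"
    have less: "fst l mod 4 < 4" "fst l' mod 4 < 4" by simp_all
    have "lit_type l = lit_type l'" using * by simp
    then have "snd l = snd l' \<and> fst l mod 4 = fst l' mod 4"
      using less unfolding lit_type_def by (auto split: if_splits)
    moreover from this have "fst l = fst l'"
      using *(3) div_mult_mod_eq[of "fst l" 4] div_mult_mod_eq[of "fst l'" 4] by linarith
    ultimately show "l = l'" by (simp add: prod_eq_iff)
  qed
  moreover have "(\<lambda>l. fst l div 4) ` {l \<in> lits n. lit_type l = a} \<subseteq> {..n div 4}"
    by (auto simp: lits_def div_le_mono)
  ultimately have "card {l \<in> lits n. lit_type l = a} \<le> card {..n div 4}"
    by (intro card_inj_on_le) auto
  then show ?thesis by simp
qed

lemma card_lists_types_le: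
  assumes c: "\<And>a. card {l \<in> L. lit_type l = a} \<le> c" and "finite L"
  shows "card {\<omega> \<in> lists_over L k. map lit_type \<omega> \<in> X} \<le> card (X \<inter> lists_over {..<8} k) * c ^ k"
proof -
  have fin: "finite (X \<inter> lists_over {..<8} k)" by (simp add: finite_lists_over)
  have "{\<omega> \<in> lists_over L k. map lit_type \<omega> \<in> X}
      \<subseteq> (\<Union>\<tau>\<in>X \<inter> lists_over {..<8} k. boxes k (\<lambda>p. {l \<in> L. lit_type l = \<tau> ! p}))"
  proof
    fix \<omega> assume *: "\<omega> \<in> {\<omega> \<in> lists_over L k. map lit_type \<omega> \<in> X}"
    then have "map lit_type \<omega> \<in> X \<inter> lists_over {..<8} k"
      using lit_type_less by (auto simp: lists_over_def)
    moreover have "\<omega> \<in> boxes k (\<lambda>p. {l \<in> L. lit_type l = map lit_type \<omega> ! p})"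
      using * nth_mem by (fastforce simp: boxes_def lists_over_def)
    ultimately show "\<omega> \<in> (\<Union>\<tau>\<in>X \<inter> lists_over {..<8} k. boxes k (\<lambda>p. {l \<in> L. lit_type l = \<tau> ! p}))"
      by blast
  qed
  then have "card {\<omega> \<in> lists_over L k. map lit_type \<omega> \<in> X}
      \<le> card (\<Union>\<tau>\<in>X \<inter> lists_over {..<8} k. boxes k (\<lambda>p. {l \<in> L. lit_type l = \<tau> ! p}))"
    using fin \<open>finite L\<close> by (intro card_mono finite_UN_I finite_boxes) auto
  also have "\<dots> \<le> (\<Sum>\<tau>\<in>X \<inter> lists_over {..<8} k. card (boxes k (\<lambda>p. {l \<in> L. lit_type l = \<tau> ! p})))"
    by (rule card_UN_le[OF fin])
  also have "\<dots> \<le> (\<Sum>\<tau>\<in>X \<inter> lists_over {..<8} k. c ^ k)"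
  proof (rule sum_mono)
    fix \<tau>
    have "(\<Prod>p<k. card {l \<in> L. lit_type l = \<tau> ! p}) \<le> (\<Prod>p<k. c)"
      using c by (intro prod_mono) auto
    then show "card (boxes k (\<lambda>p. {l \<in> L. lit_type l = \<tau> ! p})) \<le> c ^ k"
      by (simp add: card_boxes)
  qed
  finally show ?thesis by simp
qed

text \<open>Given the type list, the positions of u and v are known and only k - 2 entries are left
  to choose. The two lost factors c make the probability of a given pair of order
  \<open>1 / n^2\<close>.\<close>

lemma card_light_pair_le:
  assumes c: "\<And>a. card {l \<in> L. lit_type l = a} \<le> c" and "finite L" and k: "2 \<le> k"
  shows "card {\<omega> \<in> lists_over L k. light_pair \<omega> = (u, v)}
    \<le> card {\<tau> \<in> lists_over {..<8} k. low \<tau> = (lit_type u, lit_type v)} * c ^ (k - 2)"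
proof -
  define T where "T = {\<tau> \<in> lists_over {..<8} k. low \<tau> = (lit_type u, lit_type v)}"
  define B where "B = (\<lambda>\<tau> p. case lightest_pos \<tau> of (i, j) \<Rightarrow>
    if p = i then {u} else if p = j then {v} else {l \<in> L. lit_type l = \<tau> ! p})"
  have fin: "finite T" by (simp add: T_def finite_lists_over)
  have "{\<omega> \<in> lists_over L k. light_pair \<omega> = (u, v)} \<subseteq> (\<Union>\<tau>\<in>T. boxes k (B \<tau>))"
  proof
    fix \<omega> assume *: "\<omega> \<in> {\<omega> \<in> lists_over L k. light_pair \<omega> = (u, v)}"
    then have len: "length \<omega> = k" by (simp add: lists_over_def)
    then have "low (map lit_type \<omega>) = (lit_type u, lit_type v)"
      using low_light_pair[of \<omega>] k * by simp
    then have "map lit_type \<omega> \<in> T"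
      using * lit_type_less by (auto simp: lists_over_def T_def)
    moreover have "\<omega> \<in> boxes k (B (map lit_type \<omega>))"
      using * nth_mem by (fastforce simp: boxes_def lists_over_def B_def light_pair_def split: prod.splits)
    ultimately show "\<omega> \<in> (\<Union>\<tau>\<in>T. boxes k (B \<tau>))" by blast
  qed
  moreover have finB: "finite (boxes k (B \<tau>))" for \<tau>
    using \<open>finite L\<close> by (intro finite_boxes) (auto simp: B_def split: prod.splits)
  ultimately have "card {\<omega> \<in> lists_over L k. light_pair \<omega> = (u, v)} \<le> card (\<Union>\<tau>\<in>T. boxes k (B \<tau>))"
    using fin by (intro card_mono) auto
  also have "\<dots> \<le> (\<Sum>\<tau>\<in>T. card (boxes k (B \<tau>)))"
    by (rule card_UN_le[OF fin])
  also have "\<dots> \<le> (\<Sum>\<tau>\<in>T. c ^ (k - 2))"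
  proof (rule sum_mono)
    fix \<tau> assume "\<tau> \<in> T"
    then have len: "length \<tau> = k" by (simp add: T_def lists_over_def)
    obtain i j where ij: "lightest_pos \<tau> = (i, j)" "i < k" "j < k" "i \<noteq> j"
      using lightest_posE[of \<tau>] k unfolding len by metis
    have "card (boxes k (B \<tau>)) = card (B \<tau> i) * (card (B \<tau> j) * (\<Prod>p\<in>{..<k} - {i} - {j}. card (B \<tau> p)))"
      unfolding card_boxes using ij by (subst prod.remove[of _ i], simp_all, subst prod.remove[of _ j]) simp_all
    also have "\<dots> = (\<Prod>p\<in>{..<k} - {i} - {j}. card (B \<tau> p))"
      using ij by (simp add: B_def)
    also have "\<dots> \<le> (\<Prod>p\<in>{..<k} - {i} - {j}. c)"
      using c ij by (intro prod_mono) (auto simp: B_def)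
    also have "\<dots> = c ^ (k - 2)" using ij by (simp add: numeral_2_eq_2)
    finally show "card (boxes k (B \<tau>)) \<le> c ^ (k - 2)" .
  qed
  finally show ?thesis by (simp add: T_def)
qed

section \<open>Clauses with randomly ordered literals\<close>

text \<open>Listing the literals in random order breaks ties between literals of equal type
  symmetrically, while the strategy still sees only the set.\<close>

definition random_list :: "nat \<Rightarrow> nat \<Rightarrow> literal list pmf" where
  "random_list n k = bind_pmf (random_clause n k) (\<lambda>C. pmf_of_set (permutations_of_set C))"

lemma finite_k_clauses: "finite (k_clauses n k)"
  by (rule finite_subset[of _ "Pow ({1..n} \<times> UNIV)"]) (auto simp: k_clauses_def)

lemma k_clauses_nonempty: "k \<le> n \<Longrightarrow> k_clauses n k \<noteq> {}"
  using card_k_clauses[of n k] by force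

lemma finite_k_clause: "C \<in> k_clauses n k \<Longrightarrow> finite C"
  by (rule finite_subset[of _ "{1..n} \<times> UNIV"]) (auto simp: k_clauses_def)

lemma set_random_clause: "k \<le> n \<Longrightarrow> set_pmf (random_clause n k) = k_clauses n k"
  by (simp add: random_clause_def finite_k_clauses k_clauses_nonempty)

lemma random_list_support:
  assumes "k \<le> n" "\<omega> \<in> set_pmf (random_list n k)"
  shows "set \<omega> \<in> k_clauses n k" "distinct \<omega>" "length \<omega> = k" "\<omega> \<in> lists_over (lits n) k"
proof -
  obtain C where C: "C \<in> k_clauses n k" "\<omega> \<in> set_pmf (pmf_of_set (permutations_of_set C))"
    using assms by (auto simp: random_list_def set_random_clause)
  then have \<omega>: "set \<omega> = C" "distinct \<omega>"
    using finite_k_clause[OF C(1)] by (auto dest: permutations_of_setD)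
  with C show "set \<omega> \<in> k_clauses n k" "distinct \<omega>" by simp_all
  show "length \<omega> = k" using \<omega> C(1) distinct_card[of \<omega>] by (simp add: k_clauses_def)
  then show "\<omega> \<in> lists_over (lits n) k" using \<omega> C(1) by (simp add: k_clauses_def lists_over_def lits_def)
qed

lemma map_set_random_list:
  assumes "k \<le> n"
  shows "map_pmf set (random_list n k) = random_clause n k"
proof -
  have "map_pmf set (random_list n k) = bind_pmf (random_clause n k) return_pmf"
    unfolding random_list_def map_bind_pmf
  proof (rule bind_pmf_cong[OF refl])
    fix C assume "C \<in> set_pmf (random_clause n k)"
    then have fin: "finite C" using assms finite_k_clause by (auto simp: set_random_clause)
    have "map_pmf set (pmf_of_set (permutations_of_set C)) = map_pmf (\<lambda>_. C) (pmf_of_set (permutations_of_set C))"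
      using fin by (intro map_pmf_cong refl) (auto dest: permutations_of_setD)
    then show "map_pmf set (pmf_of_set (permutations_of_set C)) = return_pmf C"
      by (simp add: map_pmf_const)
  qed
  then show ?thesis by (simp add: bind_return_pmf')
qed

text \<open>Only the clause \<open>set \<omega>\<close> can produce \<omega>, and it does so in one
  of its k! orders.\<close>

lemma pmf_random_list_le:
  assumes "k \<le> n"
  shows "pmf (random_list n k) \<omega> \<le> 1 / real (card (k_clauses n k) * fact k)"
proof -
  have "pmf (random_list n k) \<omega>
      = (\<Sum>C\<in>k_clauses n k. pmf (pmf_of_set (permutations_of_set C)) \<omega>) / real (card (k_clauses n k))"
    unfolding random_list_def random_clause_def
    by (rule pmf_bind_pmf_of_set) (use finite_k_clauses k_clauses_nonempty assms in auto)
  also have "(\<Sum>C\<in>k_clauses n k. pmf (pmf_of_set (permutations_of_set C)) \<omega>)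
      \<le> (\<Sum>C\<in>k_clauses n k. if C = set \<omega> then 1 / fact k else 0)"
  proof (rule sum_mono)
    fix C assume C: "C \<in> k_clauses n k"
    then have fin: "finite C" "card C = k" using finite_k_clause[OF C] C by (simp_all add: k_clauses_def)
    then have "pmf (pmf_of_set (permutations_of_set C)) \<omega> = indicator (permutations_of_set C) \<omega> / fact k"
      by (subst pmf_of_set) (simp_all add: permutations_of_set_empty_iff card_permutations_of_set)
    then show "pmf (pmf_of_set (permutations_of_set C)) \<omega> \<le> (if C = set \<omega> then 1 / fact k else 0)"
      by (simp add: indicator_def permutations_of_set_def)
  qed
  also have "\<dots> \<le> 1 / fact k" using finite_k_clauses by simp
  finally show ?thesis by (simp add: divide_right_mono mult.commute)
qed

text \<open>Counting in \<open>lists_over\<close> admits lists with repeated variables, which never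
  occur. They are a vanishing fraction for large n, and with them the entries can be chosen
  independently.\<close>

lemma prob_random_list_le:
  assumes "k \<le> n"
  shows "measure_pmf.prob (random_list n k) A
    \<le> real (card (A \<inter> lists_over (lits n) k)) / real (card (k_clauses n k) * fact k)"
proof -
  have "measure_pmf.prob (random_list n k) A = measure_pmf.prob (random_list n k) (A \<inter> set_pmf (random_list n k))"
    by (simp add: measure_Int_set_pmf)
  also have "\<dots> \<le> measure_pmf.prob (random_list n k) (A \<inter> lists_over (lits n) k)"
    using random_list_support(4)[OF assms] by (intro measure_pmf.finite_measure_mono) auto
  also have "\<dots> = (\<Sum>\<omega>\<in>A \<inter> lists_over (lits n) k. pmf (random_list n k) \<omega>)"
    by (intro measure_measure_pmf_finite) (simp add: finite_lists_over)
  also have "\<dots> \<le> real (card (A \<inter> lists_over (lits n) k)) * (1 / real (card (k_clauses n k) * fact k))"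
    by (intro sum_bounded_above pmf_random_list_le assms)
  finally show ?thesis by simp
qed

section \<open>The strategy\<close>

text \<open>The factor 2 sums over which of the two clauses is selected; a tie counts once because it is
  always resolved in favour of the first clause.\<close>

definition tail_count :: "nat \<Rightarrow> int \<Rightarrow> int" where
  "tail_count k r = (\<Sum>c<8. \<Sum>d<8. low_count k c d *
     (if r < pair_weight (c, d) then 2 else if r = pair_weight (c, d) then 1 else 0))"

text \<open>Divided by \<open>8 ^ (2 * k)\<close>, this is the probability that the selected clause
  has a and b as its two smallest types, in the model where all types are independent and
  uniform.\<close>

definition pair_count :: "nat \<Rightarrow> nat \<Rightarrow> nat \<Rightarrow> int" where
  "pair_count k a b = low_count k a b * tail_count k (pair_weight (a, b))"

definition pick :: "clause list \<Rightarrow> clause" where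
  "pick cs = (if cost (cs ! 0) \<le> cost (cs ! 1) then cs ! 0 else cs ! 1)"

lemma pick_pair: "pick [C, C'] = (if cost C \<le> cost C' then C else C')"
  by (simp add: pick_def)

definition pick_list :: "literal list \<times> literal list \<Rightarrow> literal list" where
  "pick_list = (\<lambda>(\<omega>, \<omega>'). if cost (set \<omega>) \<le> cost (set \<omega>') then \<omega> else \<omega>')"

definition picked :: "nat \<Rightarrow> nat \<Rightarrow> literal list pmf" where
  "picked n k = map_pmf pick_list (pair_pmf (random_list n k) (random_list n k))"

lemma map_replicate_pmf: "map_pmf (map f) (replicate_pmf m p) = replicate_pmf m (map_pmf f p)"
proof (induction m)
  case (Suc m)
  have "replicate_pmf (Suc m) (map_pmf f p)
      = bind_pmf p (\<lambda>x. map_pmf ((#) (f x)) (map_pmf (map f) (replicate_pmf m p)))"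
    by (simp add: bind_map_pmf Suc flip: map_pmf_def)
  also have "\<dots> = map_pmf (map f) (replicate_pmf (Suc m) p)"
    by (simp add: map_bind_pmf pmf.map_comp o_def) (simp add: map_pmf_def)
  finally show ?case ..
qed simp

text \<open>A strategy that ignores the history selects independent, identically distributed
  clauses.\<close>

lemma achlioptas_formula_memoryless:
  "achlioptas_formula t k n (\<lambda>_. f) m = replicate_pmf m (map_pmf f (replicate_pmf t (random_clause n k)))"
proof (induction m)
  case 0
  show ?case by (simp add: achlioptas_formula_def)
next
  case (Suc m)
  define p where "p = map_pmf f (replicate_pmf t (random_clause n k))"
  have "achlioptas_formula t k n (\<lambda>_. f) (Suc m)
      = bind_pmf (achlioptas_formula t k n (\<lambda>_. f) m) (\<lambda>F. bind_pmf p (\<lambda>C. return_pmf (F @ [C])))"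
    by (simp add: achlioptas_formula_def p_def map_bind_pmf bind_map_pmf)
  \<comment> \<open>The process appends at the end whereas \<open>replicate_pmf\<close> adds in
    front; \<open>replicate_pmf_distrib\<close> splits off the last sample instead of the
    first.\<close>
  also have "\<dots> = replicate_pmf (m + 1) p"
    unfolding Suc p_def[symmetric] replicate_pmf_distrib
    by (simp add: bind_assoc_pmf bind_return_pmf)
  finally show ?case by (simp add: p_def)
qed

text \<open>\<open>pick_list\<close> compares the costs of the underlying sets, so the orders can be
  forgotten before or after the selection.\<close>

lemma map_set_picked:
  assumes "k \<le> n"
  shows "map_pmf set (picked n k) = map_pmf pick (replicate_pmf 2 (random_clause n k))"
proof -
  have "replicate_pmf 2 (random_clause n k) = map_pmf (\<lambda>(\<omega>, \<omega>'). [set \<omega>, set \<omega>']) (pair_pmf (random_list n k) (random_list n k))"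
    unfolding map_set_random_list[OF assms, symmetric] numeral_2_eq_2
    by (simp add: pair_pmf_def bind_map_pmf map_bind_pmf bind_assoc_pmf bind_return_pmf)
  then show ?thesis
    by (simp add: picked_def pmf.map_comp o_def pick_pair pick_list_def case_prod_beta if_distrib)
qed

lemma picked_support:
  assumes "k \<le> n" "\<omega> \<in> set_pmf (picked n k)"
  shows "set \<omega> \<in> k_clauses n k" "distinct \<omega>" "length \<omega> = k"
proof -
  have "\<omega> \<in> set_pmf (random_list n k)"
    using assms(2) by (auto simp: picked_def pick_list_def split: if_splits)
  then show "set \<omega> \<in> k_clauses n k" "distinct \<omega>" "length \<omega> = k"
    using random_list_support[OF assms(1)] by auto
qed

definition pair_dist :: "nat \<Rightarrow> nat \<Rightarrow> (literal \<times> literal) pmf" where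
  "pair_dist n k = map_pmf light_pair (picked n k)"

lemma pair_dist_support:
  assumes "2 \<le> k" "k \<le> n"
  shows "set_pmf (pair_dist n k) \<subseteq> {(u, v). u \<in> lits n \<and> v \<in> lits n \<and> fst u \<noteq> fst v}"
proof (clarify)
  fix u v :: literal assume "(u, v) \<in> set_pmf (pair_dist n k)"
  then obtain \<omega> where \<omega>: "\<omega> \<in> set_pmf (picked n k)" "light_pair \<omega> = (u, v)"
    by (auto simp: pair_dist_def)
  note s = picked_support[OF assms(2) \<omega>(1)]
  have uv: "u \<in> set \<omega>" "v \<in> set \<omega>" "u \<noteq> v"
    using light_pair_in[of \<omega> u v] s \<omega>(2) assms(1) by auto
  then show "u \<in> lits n \<and> v \<in> lits n \<and> fst u \<noteq> fst v"
    using s(1) unfolding k_clauses_def lits_def inj_on_def by blast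
qed

lemma satisfiable_if_sat2_light_pairs:
  assumes "sat2 (light_pair ` set \<Omega>)" "\<And>\<omega>. \<omega> \<in> set \<Omega> \<Longrightarrow> 2 \<le> length \<omega> \<and> distinct \<omega>"
  shows "satisfiable (map set \<Omega>)"
proof -
  obtain a where a: "\<And>u v. (u, v) \<in> light_pair ` set \<Omega> \<Longrightarrow> lit_true a u \<or> lit_true a v"
    using assms(1) unfolding sat2_def by blast
  have "\<exists>(x, b)\<in>set \<omega>. a x = b" if "\<omega> \<in> set \<Omega>" for \<omega>
  proof -
    obtain u v where uv: "light_pair \<omega> = (u, v)" by (metis surj_pair)
    then have "lit_true a u \<or> lit_true a v" using a that by (metis image_eqI)
    moreover have "u \<in> set \<omega>" "v \<in> set \<omega>" using light_pair_in[of \<omega> u v] assms(2)[OF that] uv by auto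
    ultimately show ?thesis unfolding lit_true_def case_prod_beta by blast
  qed
  then show ?thesis unfolding satisfiable_def by auto
qed

lemma prob_achlioptas_unsat_le:
  assumes "2 \<le> k" "k \<le> n"
  shows "measure_pmf.prob (achlioptas_formula 2 k n (\<lambda>_. pick) m) {F. \<not> satisfiable F}
    \<le> measure_pmf.prob (replicate_pmf m (pair_dist n k)) {\<omega>. \<not> sat2 (set \<omega>)}"
proof -
  define M where "M = replicate_pmf m (picked n k)"
  have "achlioptas_formula 2 k n (\<lambda>_. pick) m = map_pmf (map set) M"
    unfolding M_def achlioptas_formula_memoryless map_set_picked[OF assms(2), symmetric]
    by (simp add: map_replicate_pmf)
  then have "measure_pmf.prob (achlioptas_formula 2 k n (\<lambda>_. pick) m) {F. \<not> satisfiable F}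
      = measure_pmf.prob M ({\<Omega>. \<not> satisfiable (map set \<Omega>)} \<inter> set_pmf M)"
    by (simp add: measure_Int_set_pmf vimage_def)
  also have "\<dots> \<le> measure_pmf.prob M {\<Omega>. \<not> sat2 (light_pair ` set \<Omega>)}"
  proof (rule measure_pmf.finite_measure_mono)
    show "{\<Omega>. \<not> satisfiable (map set \<Omega>)} \<inter> set_pmf M \<subseteq> {\<Omega>. \<not> sat2 (light_pair ` set \<Omega>)}"
    proof (clarify)
      fix \<Omega> assume \<Omega>: "\<Omega> \<in> set_pmf M" "sat2 (light_pair ` set \<Omega>)" "\<not> satisfiable (map set \<Omega>)"
      then have "2 \<le> length \<omega> \<and> distinct \<omega>" if "\<omega> \<in> set \<Omega>" for \<omega>
        using picked_support[OF assms(2), of \<omega>] that assms(1) by (auto simp: M_def set_replicate_pmf)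
      then show False using satisfiable_if_sat2_light_pairs \<Omega> by blast
    qed
  qed simp
  also have "\<dots> = measure_pmf.prob (replicate_pmf m (pair_dist n k)) {\<omega>. \<not> sat2 (set \<omega>)}"
    unfolding pair_dist_def M_def map_replicate_pmf[symmetric] by (simp add: vimage_def)
  finally show ?thesis .
qed

text \<open>One clause must have the light pair (u, v), and the other, independent of it, must cost
  at least as much; the first probability uses the exact literals, the second only types.\<close>

lemma prob_pair_dist_le:
  assumes k: "2 \<le> k" "k \<le> n"
  shows "measure_pmf.prob (pair_dist n k) {(u, v)}
    \<le> real_of_int (pair_count k (lit_type u) (lit_type v)) * real (n div 4 + 1) ^ (2 * k - 2)
      / (real (card (k_clauses n k) * fact k))\<^sup>2"
proof -
  define T where "T = random_list n k"
  define c where "c = n div 4 + 1"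
  define q where "q = real (card (k_clauses n k) * fact k)"
  define a where "a = lit_type u"
  define b where "b = lit_type v"
  define r where "r = pair_weight (a, b)"
  define A where "A = {\<omega>. light_pair \<omega> = (u, v)}"
  define G where "G = {\<omega>. r \<le> pair_weight (low (map lit_type \<omega>))}"
  define G' where "G' = {\<omega>. r < pair_weight (low (map lit_type \<omega>))}"
  have q0: "0 \<le> q" by (simp add: q_def)
  have ab: "a < 8" "b < 8" by (simp_all add: a_def b_def lit_type_less)
  have cls: "card {l \<in> lits n. lit_type l = t} \<le> c" for t
    unfolding c_def by (rule card_lits_type_le)
  have PA: "measure_pmf.prob T A \<le> real_of_int (low_count k a b) * real c ^ (k - 2) / q"
  proof -
    have "card (A \<inter> lists_over (lits n) k) \<le> card {\<tau> \<in> lists_over {..<8} k. low \<tau> = (a, b)} * c ^ (k - 2)"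
      using card_light_pair_le[OF cls finite_lits k(1), of u v]
      by (simp add: A_def a_def b_def Int_def conj_commute)
    then have "real (card (A \<inter> lists_over (lits n) k))
        \<le> real (card {\<tau> \<in> lists_over {..<8} k. low \<tau> = (a, b)}) * real c ^ (k - 2)"
      unfolding of_nat_power[symmetric] of_nat_mult[symmetric] by (rule of_nat_mono)
    also have "\<dots> \<le> real_of_int (low_count k a b) * real c ^ (k - 2)"
    proof (rule mult_right_mono)
      show "real (card {\<tau> \<in> lists_over {..<8} k. low \<tau> = (a, b)}) \<le> real_of_int (low_count k a b)"
        using card_low_le[OF k(1) ab] by linarith
    qed simp
    finally show ?thesis
      using prob_random_list_le[OF k(2), of A] q0 unfolding T_def q_def[symmetric]
      by (meson divide_right_mono order_trans)
  qed
  have PG: "measure_pmf.prob T {\<omega>. Q (low (map lit_type \<omega>))}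
      \<le> real_of_int (\<Sum>c<8. \<Sum>d<8. if Q (c, d) then low_count k c d else 0) * real c ^ k / q" for Q
  proof -
    have "card ({\<omega>. Q (low (map lit_type \<omega>))} \<inter> lists_over (lits n) k)
        \<le> card {\<tau> \<in> lists_over {..<8} k. Q (low \<tau>)} * c ^ k"
      using card_lists_types_le[OF cls finite_lits, of k "{\<tau>. Q (low \<tau>)}"]
      by (simp add: Int_def conj_commute)
    then have "real (card ({\<omega>. Q (low (map lit_type \<omega>))} \<inter> lists_over (lits n) k))
        \<le> real (card {\<tau> \<in> lists_over {..<8} k. Q (low \<tau>)}) * real c ^ k"
      unfolding of_nat_power[symmetric] of_nat_mult[symmetric] by (rule of_nat_mono)
    also have "\<dots> \<le> real_of_int (\<Sum>c<8. \<Sum>d<8. if Q (c, d) then low_count k c d else 0) * real c ^ k"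
    proof (rule mult_right_mono)
      show "real (card {\<tau> \<in> lists_over {..<8} k. Q (low \<tau>)})
          \<le> real_of_int (\<Sum>c<8. \<Sum>d<8. if Q (c, d) then low_count k c d else 0)"
        using card_low_Collect_le[OF k(1), of Q] by linarith
    qed simp
    finally show ?thesis
      using prob_random_list_le[OF k(2), of "{\<omega>. Q (low (map lit_type \<omega>))}"] q0
      unfolding T_def q_def[symmetric] by (meson divide_right_mono order_trans)
  qed
  have "tail_count k r = (\<Sum>c<8. \<Sum>d<8. if r \<le> pair_weight (c, d) then low_count k c d else 0)
      + (\<Sum>c<8. \<Sum>d<8. if r < pair_weight (c, d) then low_count k c d else 0)"
    unfolding tail_count_def sum.distrib[symmetric] by (intro sum.cong refl) auto
  then have PGG: "measure_pmf.prob T G + measure_pmf.prob T G' \<le> real_of_int (tail_count k r) * real c ^ k / q"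
    using PG[of "\<lambda>cd. r \<le> pair_weight cd"] PG[of "\<lambda>cd. r < pair_weight cd"]
    unfolding G_def G'_def by (simp only: of_int_add add_divide_distrib distrib_right)
  have "measure_pmf.prob (pair_dist n k) {(u, v)}
      = measure_pmf.prob (pair_pmf T T) ({p. light_pair (pick_list p) = (u, v)} \<inter> set_pmf (pair_pmf T T))"
    unfolding measure_Int_set_pmf by (simp add: pair_dist_def picked_def T_def vimage_def)
  \<comment> \<open>If the first clause is selected, the second costs at least r; if the second is
    selected, the first costs strictly more, because ties go to the first.\<close>
  also have "\<dots> \<le> measure_pmf.prob (pair_pmf T T) (A \<times> G \<union> G' \<times> A)"
  proof (rule measure_pmf.finite_measure_mono)
    show "{p. light_pair (pick_list p) = (u, v)} \<inter> set_pmf (pair_pmf T T) \<subseteq> A \<times> G \<union> G' \<times> A"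
    proof (rule subsetI)
      fix p assume p: "p \<in> {p. light_pair (pick_list p) = (u, v)} \<inter> set_pmf (pair_pmf T T)"
      obtain \<omega> \<omega>' where \<omega>: "p = (\<omega>, \<omega>')" by (metis surj_pair)
      with p have *: "light_pair (pick_list (\<omega>, \<omega>')) = (u, v)" "(\<omega>, \<omega>') \<in> set_pmf (pair_pmf T T)"
        by auto
      then have len: "2 \<le> length \<omega>" "distinct \<omega>" "2 \<le> length \<omega>'" "distinct \<omega>'"
        using random_list_support[OF k(2)] k(1) by (auto simp: T_def)
      have r: "pair_weight (low (map lit_type \<omega>'')) = r" if "light_pair \<omega>'' = (u, v)" "2 \<le> length \<omega>''" for \<omega>''
        using low_light_pair[OF that(2)] that(1) by (simp add: r_def a_def b_def)
      show "p \<in> A \<times> G \<union> G' \<times> A"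
        unfolding \<omega> using * r[of \<omega>] r[of \<omega>'] len cost_set[of \<omega>] cost_set[of \<omega>']
        by (auto simp: pick_list_def A_def G_def G'_def split: if_splits)
    qed
  qed simp
  also have "\<dots> \<le> measure_pmf.prob (pair_pmf T T) (A \<times> G) + measure_pmf.prob (pair_pmf T T) (G' \<times> A)"
    by (rule measure_Un_le) auto
  also have "\<dots> = measure_pmf.prob T A * (measure_pmf.prob T G + measure_pmf.prob T G')"
    by (simp add: measure_pmf_prob_product countableI_type algebra_simps)
  also have "\<dots> \<le> (real_of_int (low_count k a b) * real c ^ (k - 2) / q) * (real_of_int (tail_count k r) * real c ^ k / q)"
    by (intro mult_mono PA PGG order_trans[OF _ PA]) auto
  also have "\<dots> = real_of_int (pair_count k a b) * real c ^ (2 * k - 2) / q\<^sup>2"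
  proof -
    have "2 * k - 2 = (k - 2) + k" using k(1) by simp
    then have "real c ^ (2 * k - 2) = real c ^ (k - 2) * real c ^ k" by (simp only: power_add)
    then show ?thesis by (simp add: pair_count_def r_def power2_eq_square)
  qed
  finally show ?thesis unfolding a_def b_def c_def q_def .
qed

section \<open>Numerical verification of subcriticality\<close>

definition low_table :: "nat \<Rightarrow> (int \<times> int) list" where
  "low_table k = map (\<lambda>(c, d). (pair_weight (c, d), low_count k c d)) [(c, d). c \<leftarrow> [0..<8], d \<leftarrow> [c..<8]]"

definition tail_sum :: "(int \<times> int) list \<Rightarrow> int \<Rightarrow> int" where
  "tail_sum T r = (\<Sum>(p, c)\<leftarrow>T. c * (if r < p then 2 else if r = p then 1 else 0))"

text \<open>The list T is a parameter so that evaluation computes it once and shares it among all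
  entries.\<close>

definition pair_table :: "nat \<Rightarrow> (int \<times> int) list \<Rightarrow> int list list" where
  "pair_table k T = map (\<lambda>a. map (\<lambda>b. if b < a then 0 else low_count k a b * tail_sum T (pair_weight (a, b))) [0..<8]) [0..<8]"

text \<open>This is the strict supersolution inequality in the row of type 7 - a, multiplied out. An
  implication from a literal of type 7 - a comes from a pair, in either order, that contains its
  negation, of type a. The scale is \<open>4 * (25 / 36) * 2 ^ k / 8 ^ (2 * k)\<close>, with the
  factor 4 because each type has about n / 4 literals.\<close>

definition rows_ok :: "nat \<Rightarrow> int list list \<Rightarrow> bool" where
  "rows_ok k H \<longleftrightarrow> (\<forall>a\<in>set [0..<8].
     25 * 2 ^ k * (\<Sum>b\<leftarrow>[0..<8]. (H ! a ! b + H ! b ! a) * weight b ^ k) < 9 * 8 ^ (2 * k) * weight (7 - a) ^ k)"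

lemma low_count_eq_0: "b < a \<Longrightarrow> low_count k a b = 0"
  by (simp add: low_count_def)

lemma sum_lessThan_8: "(\<Sum>c<8. f c) = f 0 + f 1 + f 2 + f 3 + f 4 + f 5 + f 6 + f (7::nat)"
  by (simp add: eval_nat_numeral)

lemma tail_sum_low_table: "tail_sum (low_table k) r = tail_count k r"
proof -
  have "[(c, d). c \<leftarrow> [0..<8::nat], d \<leftarrow> [c..<8]] =
    [(0,0),(0,1),(0,2),(0,3),(0,4),(0,5),(0,6),(0,7),
     (1,1),(1,2),(1,3),(1,4),(1,5),(1,6),(1,7),
     (2,2),(2,3),(2,4),(2,5),(2,6),(2,7),
     (3,3),(3,4),(3,5),(3,6),(3,7),
     (4,4),(4,5),(4,6),(4,7),(5,5),(5,6),(5,7),(6,6),(6,7),(7,7)]"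
    by code_simp
  then show ?thesis
    unfolding tail_sum_def low_table_def tail_count_def sum_lessThan_8
    by (simp only: list.map sum_list.Cons sum_list.Nil prod.case low_count_eq_0 add_0_left add_0_right
      mult_zero_left add.assoc)
qed

lemma pair_table_nth:
  assumes "a < 8" "b < 8"
  shows "pair_table k (low_table k) ! a ! b = pair_count k a b"
proof -
  have "pair_table k (low_table k) ! a ! b = (if b < a then 0 else pair_count k a b)"
    using assms by (simp add: pair_table_def tail_sum_low_table pair_count_def)
  then show ?thesis by (simp add: pair_count_def low_count_eq_0)
qed

text \<open>One goal per \<open>k\<close>: under a quantifier, the simplifier would unfold \<^const>\<open>rows_ok\<close> before
  computing the table and thereby evaluate the table many times.\<close>

lemma rows_ok_tables:
  "rows_ok 5 (pair_table 5 (low_table 5))"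
  "rows_ok 6 (pair_table 6 (low_table 6))"
  "rows_ok 7 (pair_table 7 (low_table 7))"
  "rows_ok 8 (pair_table 8 (low_table 8))"
  "rows_ok 9 (pair_table 9 (low_table 9))"
  "rows_ok 10 (pair_table 10 (low_table 10))"
  "rows_ok 11 (pair_table 11 (low_table 11))"
  "rows_ok 12 (pair_table 12 (low_table 12))"
  "rows_ok 13 (pair_table 13 (low_table 13))"
  "rows_ok 14 (pair_table 14 (low_table 14))"
  "rows_ok 15 (pair_table 15 (low_table 15))"
  "rows_ok 16 (pair_table 16 (low_table 16))"
  "rows_ok 17 (pair_table 17 (low_table 17))"
  "rows_ok 18 (pair_table 18 (low_table 18))"
  "rows_ok 19 (pair_table 19 (low_table 19))"
  "rows_ok 20 (pair_table 20 (low_table 20))"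
  "rows_ok 21 (pair_table 21 (low_table 21))"
  "rows_ok 22 (pair_table 22 (low_table 22))"
  "rows_ok 23 (pair_table 23 (low_table 23))"
  "rows_ok 24 (pair_table 24 (low_table 24))"
  "rows_ok 25 (pair_table 25 (low_table 25))"
  by code_simp+

lemma row_inequality:
  assumes k: "5 \<le> k" "k \<le> 25" and a: "a < 8"
  shows "25 * 2 ^ k * (\<Sum>b<8. (pair_count k a b + pair_count k b a) * weight b ^ k)
    < 9 * 8 ^ (2 * k) * weight (7 - a) ^ k"
proof -
  have "\<forall>k\<in>set [5..<26]. rows_ok k (pair_table k (low_table k))"
    by (simp add: rows_ok_tables)
  moreover have "k \<in> set [5..<26]" unfolding set_upt using k by simp
  ultimately have "rows_ok k (pair_table k (low_table k))" by blast
  moreover have "a \<in> set [0..<8]" unfolding set_upt using a by simp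
  ultimately have "25 * 2 ^ k * (\<Sum>b\<leftarrow>[0..<8]. (pair_table k (low_table k) ! a ! b + pair_table k (low_table k) ! b ! a) * weight b ^ k)
      < 9 * 8 ^ (2 * k) * weight (7 - a) ^ k"
    unfolding rows_ok_def by blast
  moreover have "(\<Sum>b\<leftarrow>[0..<8]. (pair_table k (low_table k) ! a ! b + pair_table k (low_table k) ! b ! a) * weight b ^ k)
      = (\<Sum>b<8. (pair_count k a b + pair_count k b a) * weight b ^ k)"
    unfolding interv_sum_list_conv_sum_set_nat using a
    by (intro sum.cong) (auto simp: pair_table_nth)
  ultimately show ?thesis by (simp only:)
qed

section \<open>Unsatisfiability of the random formula\<close>

lemma prob_replicate_pmf_Ball:
  "measure_pmf.prob (replicate_pmf m p) {xs. \<forall>x\<in>set xs. Q x} = measure_pmf.prob p {x. Q x} ^ m"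
proof (induction m)
  case (Suc m)
  have *: "measure_pmf.prob (replicate_pmf m p) {xs. Q x \<and> (\<forall>x\<in>set xs. Q x)}
      = indicator {x. Q x} x * measure_pmf.prob p {x. Q x} ^ m" for x
    using Suc by (cases "Q x") simp_all
  have "measure_pmf.prob (replicate_pmf (Suc m) p) {xs. \<forall>x\<in>set xs. Q x}
      = (\<integral>x. measure_pmf.prob (replicate_pmf m p) {xs. Q x \<and> (\<forall>x\<in>set xs. Q x)} \<partial>measure_pmf p)"
    by (simp add: measure_bind_pmf_eq flip: map_pmf_def)
  also have "\<dots> = measure_pmf.prob p {x. Q x} ^ Suc m"
    unfolding * by simp
  finally show ?case .
qed simp

text \<open>On every set of k variables one of the \<open>2 ^ k\<close> sign patterns is falsified
  by the assignment X.\<close>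

lemma prob_random_clause_true_le:
  assumes "k \<le> n"
  shows "measure_pmf.prob (random_clause n k) {C. \<exists>(x, b)\<in>C. (x \<in> X) = b} \<le> 1 - 1 / 2 ^ k"
proof -
  define Q where "Q = {C :: clause. \<exists>(x, b)\<in>C. (x \<in> X) = b}"
  define g where "g = (\<lambda>V :: nat set. (\<lambda>x. (x, x \<notin> X)) ` V)"
  define A where "A = {V. V \<subseteq> {1..n} \<and> card V = k}"
  have fst_g: "fst ` g V = V" for V by (force simp: g_def)
  have "inj_on g A" by (rule inj_onI) (metis fst_g)
  then have "card A = card (g ` A)" by (simp add: card_image)
  also have "\<dots> \<le> card (k_clauses n k \<inter> - Q)"
  proof (rule card_mono)
    show "g ` A \<subseteq> k_clauses n k \<inter> - Q"
      by (auto simp: g_def A_def k_clauses_def Q_def inj_on_def card_image)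
  qed (simp add: finite_k_clauses)
  finally have "n choose k \<le> card (k_clauses n k \<inter> - Q)"
    by (simp add: A_def n_subsets)
  moreover have "0 < n choose k" using assms by simp
  ultimately have "1 / 2 ^ k \<le> real (card (k_clauses n k \<inter> - Q)) / real (card (k_clauses n k))"
    by (simp add: card_k_clauses field_simps)
  also have "\<dots> = measure_pmf.prob (random_clause n k) (- Q)"
    unfolding random_clause_def using assms
    by (simp add: measure_pmf_of_set finite_k_clauses k_clauses_nonempty)
  also have "\<dots> = 1 - measure_pmf.prob (random_clause n k) Q"
    using measure_pmf.prob_compl[of Q "random_clause n k"] by (simp add: Compl_eq_Diff_UNIV)
  finally show ?thesis by (simp add: Q_def)
qed

lemma prob_random_formula_satisfiable_le:
  assumes "k \<le> n"
  shows "measure_pmf.prob (random_formula k n m) {F. satisfiable F} \<le> 2 ^ n * (1 - 1 / 2 ^ k) ^ m"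
proof -
  define E where "E = (\<lambda>X. {F :: clause list. \<forall>C\<in>set F. \<exists>(x, b)\<in>C. (x \<in> X) = b})"
  define M where "M = random_formula k n m"
  have "measure_pmf.prob M {F. satisfiable F} = measure_pmf.prob M ({F. satisfiable F} \<inter> set_pmf M)"
    by (simp add: measure_Int_set_pmf)
  also have "\<dots> \<le> measure_pmf.prob M (\<Union>X\<in>Pow {1..n}. E X)"
  proof (rule measure_pmf.finite_measure_mono)
    show "{F. satisfiable F} \<inter> set_pmf M \<subseteq> (\<Union>X\<in>Pow {1..n}. E X)"
    proof (rule subsetI)
      fix F assume F: "F \<in> {F. satisfiable F} \<inter> set_pmf M"
      then have sub: "C \<subseteq> {1..n} \<times> UNIV" if "C \<in> set F" for C
        using that set_random_clause[OF assms]
        unfolding M_def random_formula_def set_replicate_pmf k_clauses_def by blast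
      have "satisfiable F" using F by simp
      then obtain a where a: "\<forall>C\<in>set F. \<exists>(x, b)\<in>C. a x = b"
        unfolding satisfiable_def ..
      have "\<exists>(x, b)\<in>C. (x \<in> {x \<in> {1..n}. a x}) = b" if C: "C \<in> set F" for C
      proof -
        obtain l where l: "l \<in> C" "a (fst l) = snd l"
          using bspec[OF a C] by (auto simp: case_prod_beta)
        then have "fst l \<in> {1..n}" using sub[OF C] by (cases l) auto
        with l show ?thesis by (intro bexI[of _ l]) (simp_all add: case_prod_beta)
      qed
      then have "F \<in> E {x \<in> {1..n}. a x}" unfolding E_def by blast
      \<comment> \<open>Setting the variables outside \<open>{1..n}\<close> to false leaves
        \<open>2 ^ n\<close> assignments for the union bound.\<close>
      then show "F \<in> (\<Union>X\<in>Pow {1..n}. E X)" by (rule UN_I[rotated]) auto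
    qed
  qed simp
  also have "\<dots> \<le> (\<Sum>X\<in>Pow {1..n}. measure_pmf.prob M (E X))"
    by (intro measure_pmf.finite_measure_subadditive_finite) auto
  also have "\<dots> \<le> (\<Sum>X\<in>Pow {1..n}. (1 - 1 / 2 ^ k) ^ m)"
    unfolding M_def random_formula_def E_def prob_replicate_pmf_Ball
    by (intro sum_mono power_mono prob_random_clause_true_le assms) auto
  also have "\<dots> = 2 ^ n * (1 - 1 / 2 ^ k) ^ m" by (simp add: card_Pow)
  finally show ?thesis by (simp add: M_def)
qed

lemma random_formula_unsatisfiable_limit:
  fixes \<alpha> :: real
  assumes k: "1 \<le> k" and \<alpha>: "25 / 36 * 2 ^ k \<le> \<alpha>"
  shows "(\<lambda>n. measure_pmf.prob (random_formula k n (nat \<lfloor>\<alpha> * real n\<rfloor>)) {F. \<not> satisfiable F}) \<longlonglongrightarrow> 1"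
proof -
  define x :: real where "x = 1 / 2 ^ k"
  define \<delta> where "\<delta> = - ln (1 - x)"
  have x: "0 < x" "x < 1" using k by (simp_all add: x_def one_less_power)
  \<comment> \<open>The strictness of r < 1 is obtained here; ln 2 and 25/36 are compared only
    weakly.\<close>
  have "ln (1 - x) < - x" using ln_le_minus_one[of "1 - x"] ln_eq_minus_one[of "1 - x"] x by force
  then have \<delta>: "x < \<delta>" by (simp add: \<delta>_def)
  have \<alpha>0: "0 < \<alpha>" using \<alpha> by (rule less_le_trans[rotated]) simp
  define r where "r = 2 * exp (- \<delta> * \<alpha>)"
  have "ln 2 \<le> 25 / (36 :: real)" by (rule ln2_le_25_over_36)
  also have "\<dots> = x * (25 / 36 * 2 ^ k)" by (simp add: x_def)
  also have "\<dots> \<le> x * \<alpha>" using \<alpha> x by (intro mult_left_mono) auto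
  also have "\<dots> < \<delta> * \<alpha>" using \<delta> \<alpha>0 by simp
  finally have "exp (ln 2 - \<delta> * \<alpha>) < (1 :: real)" by simp
  then have r: "0 \<le> r" "r < 1" by (simp_all add: r_def exp_diff exp_minus field_simps)
  have bound: "measure_pmf.prob (random_formula k n (nat \<lfloor>\<alpha> * real n\<rfloor>)) {F. satisfiable F} \<le> exp \<delta> * r ^ n"
    if "k \<le> n" for n
  proof -
    define m where "m = nat \<lfloor>\<alpha> * real n\<rfloor>"
    have m: "\<alpha> * real n - 1 \<le> real m" unfolding m_def by linarith
    have "(1 - x) ^ m = exp (- \<delta> * real m)"
      using x by (simp add: \<delta>_def exp_of_nat2_mult)
    \<comment> \<open>Rounding down loses at most one clause, which costs the constant factor
      \<open>exp \<delta>\<close>.\<close>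
    also have "\<dots> \<le> exp (- \<delta> * (\<alpha> * real n - 1))"
      using m \<delta> x by simp
    also have "\<dots> = exp \<delta> * exp (- \<delta> * \<alpha>) ^ n"
      by (simp add: exp_of_nat2_mult[symmetric] exp_add[symmetric] algebra_simps)
    finally have "2 ^ n * (1 - x) ^ m \<le> exp \<delta> * r ^ n"
      by (simp add: r_def power_mult_distrib mult_ac)
    then show ?thesis
      using prob_random_formula_satisfiable_le[OF that, of m] by (simp add: x_def m_def)
  qed
  have up: "(\<lambda>n. exp \<delta> * r ^ n) \<longlonglongrightarrow> exp \<delta> * 0"
    by (intro tendsto_intros LIMSEQ_realpow_zero r)
  have lim: "(\<lambda>n. measure_pmf.prob (random_formula k n (nat \<lfloor>\<alpha> * real n\<rfloor>)) {F. satisfiable F}) \<longlonglongrightarrow> 0"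
  proof (rule tendsto_sandwich[OF _ _ tendsto_const])
    show "\<forall>\<^sub>F n in sequentially. measure_pmf.prob (random_formula k n (nat \<lfloor>\<alpha> * real n\<rfloor>)) {F. satisfiable F} \<le> exp \<delta> * r ^ n"
      using eventually_ge_at_top[of k] by eventually_elim (rule bound)
    show "(\<lambda>n. exp \<delta> * r ^ n) \<longlonglongrightarrow> 0" using up by simp
  qed simp
  have "measure_pmf.prob q {F. \<not> satisfiable F} = 1 - measure_pmf.prob q {F. satisfiable F}" for q
    using measure_pmf.prob_compl[of "{F. satisfiable F}" q] by (simp add: Compl_eq_Diff_UNIV[symmetric] Collect_neg_eq)
  then show ?thesis using tendsto_diff[OF tendsto_const lim, of 1] by simp
qed

section \<open>Satisfiability of the selected formula\<close>

text \<open>The right-hand side is \<open>2 ^ k\<close> times a falling factorial of n whose k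
  factors all exceed n - k.\<close>

lemma power_diff_le_card_k_clauses:
  assumes "k \<le> n"
  shows "2 ^ k * real (n - k) ^ k \<le> real (card (k_clauses n k) * fact k)"
proof -
  have "real (n - k) ^ k = (\<Prod>i<k. real (n - k))" by simp
  also have "\<dots> \<le> (\<Prod>i<k. real (n - i) / real (k - i) * real (k - i))"
    using assms by (intro prod_mono) auto
  also have "\<dots> = real (n choose k) * fact k"
    using assms by (simp only: prod.distrib binomial_altdef_of_nat fact_prod_rev of_nat_prod lessThan_atLeast0)
  finally show ?thesis by (simp add: card_k_clauses)
qed

definition edge_bound :: "nat \<Rightarrow> nat \<Rightarrow> nat \<Rightarrow> real" where
  "edge_bound k a b = real_of_int (pair_count k a b + pair_count k b a)"

lemma low_count_nonneg: "2 \<le> k \<Longrightarrow> a < 8 \<Longrightarrow> b < 8 \<Longrightarrow> 0 \<le> low_count k a b"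
  using card_low_le[of k a b] by linarith

lemma pair_count_nonneg:
  assumes "2 \<le> k" "a < 8" "b < 8"
  shows "0 \<le> pair_count k a b"
  unfolding pair_count_def tail_count_def
  by (intro mult_nonneg_nonneg sum_nonneg low_count_nonneg) (use assms in auto)

lemma edge_bound_nonneg: "2 \<le> k \<Longrightarrow> a < 8 \<Longrightarrow> b < 8 \<Longrightarrow> 0 \<le> edge_bound k a b"
  unfolding edge_bound_def using pair_count_nonneg by (simp add: add_nonneg_nonneg)

definition clause_density :: "nat \<Rightarrow> real" where
  "clause_density k = 25 / 36 * 2 ^ k"

text \<open>For \<open>n \<le> k\<close> the denominators vanish.\<close>

definition edge_scale :: "nat \<Rightarrow> nat \<Rightarrow> real" where
  "edge_scale k n = clause_density k * (real n / real (n - k)) * (real (n div 4 + 1) / real (n - k)) ^ (2 * k - 1) / 4 ^ k"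

lemma edge_scale_limit:
  assumes "1 \<le> k"
  shows "edge_scale k \<longlonglongrightarrow> 4 * clause_density k / 8 ^ (2 * k)"
proof -
  have 1: "(\<lambda>n. real n / real (n - k)) \<longlonglongrightarrow> 1"
  proof (rule Lim_transform_eventually)
    show "(\<lambda>n. real n / (real n - real k)) \<longlonglongrightarrow> 1" by real_asymp
    show "\<forall>\<^sub>F n in sequentially. real n / (real n - real k) = real n / real (n - k)"
      using eventually_ge_at_top[of k] by eventually_elim (simp add: of_nat_diff)
  qed
  have 2: "(\<lambda>n. real (n div 4 + 1) / real (n - k)) \<longlonglongrightarrow> 1 / 4"
  proof (rule tendsto_sandwich)
    show "(\<lambda>n. (real n / 4) / (real n - real k)) \<longlonglongrightarrow> 1 / 4" by real_asymp
    show "(\<lambda>n. (real n / 4 + 1) / (real n - real k)) \<longlonglongrightarrow> 1 / 4" by real_asymp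
    have *: "real n / 4 \<le> real (n div 4 + 1)" "real (n div 4 + 1) \<le> real n / 4 + 1" for n by linarith+
    show "\<forall>\<^sub>F n in sequentially. (real n / 4) / (real n - real k) \<le> real (n div 4 + 1) / real (n - k)"
      using eventually_ge_at_top[of k]
      by eventually_elim (simp only: of_nat_diff, intro divide_right_mono *, simp)
    show "\<forall>\<^sub>F n in sequentially. real (n div 4 + 1) / real (n - k) \<le> (real n / 4 + 1) / (real n - real k)"
      using eventually_ge_at_top[of k]
      by eventually_elim (simp only: of_nat_diff, intro divide_right_mono *, simp)
  qed
  have "(\<lambda>n. edge_scale k n) \<longlonglongrightarrow> clause_density k * 1 * (1 / 4) ^ (2 * k - 1) / 4 ^ k"
    unfolding edge_scale_def by (intro tendsto_intros 1 2) auto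
  moreover have "clause_density k * 1 * (1 / 4) ^ (2 * k - 1) / 4 ^ k = 4 * clause_density k / 8 ^ (2 * k)"
  proof -
    have "(8 :: real) ^ (2 * k) = 4 ^ (2 * k) * 4 ^ k"
      by (simp add: power_mult power_mult_distrib[symmetric])
    moreover have "(4 :: real) ^ (2 * k) = 4 * 4 ^ (2 * k - 1)"
      using assms by (cases k) auto
    ultimately show ?thesis by (simp add: power_one_over)
  qed
  ultimately show ?thesis by simp
qed

text \<open>The factor \<open>1 / real (n div 4 + 1)\<close> is kept apart because it cancels
  against the number of literals of one type when a row is summed.\<close>

lemma edge_weight_le:
  fixes n k :: nat
  defines "m \<equiv> nat \<lfloor>clause_density k * real n\<rfloor>"
  assumes k: "2 \<le> k" "k < n"
  shows "real m * measure_pmf.prob (pair_dist n k) (edge_event u v)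
    \<le> edge_scale k n * edge_bound k (7 - lit_type u) (lit_type v) / real (n div 4 + 1)"
proof -
  define c where "c = real (n div 4 + 1)"
  define q where "q = real (card (k_clauses n k) * fact k)"
  define d where "d = real (n - k)"
  define h where "h = edge_bound k (7 - lit_type u) (lit_type v)"
  have c: "0 < c" by (simp add: c_def)
  have d: "0 < d" using k by (simp add: d_def)
  have q: "2 ^ k * d ^ k \<le> q" unfolding q_def d_def using k by (intro power_diff_le_card_k_clauses) simp
  have q0: "0 < q" by (rule less_le_trans[OF _ q]) (simp add: d)
  have h0: "0 \<le> h" unfolding h_def using k lit_type_less[of v] by (intro edge_bound_nonneg) auto
  have "edge_event u v = {(neg u, v)} \<union> {(v, neg u)}" by (auto simp: edge_event_def)
  then have "measure_pmf.prob (pair_dist n k) (edge_event u v)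
      \<le> measure_pmf.prob (pair_dist n k) {(neg u, v)} + measure_pmf.prob (pair_dist n k) {(v, neg u)}"
    by (simp only:) (rule measure_Un_le; simp)
  also have "\<dots> \<le> real_of_int (pair_count k (lit_type (neg u)) (lit_type v)) * c ^ (2 * k - 2) / q\<^sup>2
      + real_of_int (pair_count k (lit_type v) (lit_type (neg u))) * c ^ (2 * k - 2) / q\<^sup>2"
    unfolding c_def q_def using k by (intro add_mono prob_pair_dist_le) auto
  also have "\<dots> = h * c ^ (2 * k - 2) / q\<^sup>2"
    by (simp add: h_def edge_bound_def lit_type_neg add_divide_distrib distrib_right)
  also have "\<dots> \<le> h * c ^ (2 * k - 2) / (2 ^ k * d ^ k)\<^sup>2"
    using q q0 d c h0 by (intro divide_left_mono power_mono mult_nonneg_nonneg mult_pos_pos zero_less_power) auto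
  finally have p: "measure_pmf.prob (pair_dist n k) (edge_event u v) \<le> h * c ^ (2 * k - 2) / (2 ^ k * d ^ k)\<^sup>2" .
  have m: "real m \<le> clause_density k * real n"
  proof -
    have "0 \<le> clause_density k * real n" by (simp add: clause_density_def)
    then show ?thesis unfolding m_def by linarith
  qed
  have "real m * measure_pmf.prob (pair_dist n k) (edge_event u v)
      \<le> (clause_density k * real n) * (h * c ^ (2 * k - 2) / (2 ^ k * d ^ k)\<^sup>2)"
    using h0 c by (intro mult_mono m p) (auto simp: clause_density_def)
  also have "\<dots> = edge_scale k n * h / c"
  proof -
    obtain j where j: "k = Suc j" using k by (cases k) auto
    have "(2 ^ k * d ^ k)\<^sup>2 = 4 ^ k * (d * d ^ (2 * k - 1))"
    proof -
      have "((2::real) ^ k)\<^sup>2 = (2\<^sup>2) ^ k" by (simp only: power_mult[symmetric] mult.commute)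
      moreover have "Suc (2 * k - 1) = 2 * k" using k by simp
      then have "(d ^ k)\<^sup>2 = d ^ Suc (2 * k - 1)" by (simp only: power_even_eq)
      ultimately show ?thesis by (simp add: power_mult_distrib)
    qed
    moreover have "c ^ (2 * k - 1) = c * c ^ (2 * k - 2)" unfolding j by simp
    ultimately show ?thesis
      using c d unfolding edge_scale_def c_def[symmetric] d_def[symmetric] by (simp add: power_divide mult_ac)
  qed
  finally show ?thesis unfolding h_def c_def .
qed

lemma sum_lits_by_type:
  fixes g :: "nat \<Rightarrow> real"
  assumes "\<And>b. b < 8 \<Longrightarrow> 0 \<le> g b"
  shows "(\<Sum>v\<in>lits n. g (lit_type v)) \<le> real (n div 4 + 1) * (\<Sum>b<8. g b)"
proof -
  have "(\<Sum>v\<in>lits n. g (lit_type v)) = (\<Sum>b<8. \<Sum>v\<in>{v \<in> lits n. lit_type v = b}. g (lit_type v))"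
    by (rule sum.group[symmetric]) (use lit_type_less in auto)
  also have "\<dots> = (\<Sum>b<8. real (card {v \<in> lits n. lit_type v = b}) * g b)"
    by simp
  also have "\<dots> \<le> (\<Sum>b<8. real (n div 4 + 1) * g b)"
  proof (rule sum_mono)
    fix b :: nat assume "b \<in> {..<8}"
    then show "real (card {v \<in> lits n. lit_type v = b}) * g b \<le> real (n div 4 + 1) * g b"
      using assms[of b] card_lits_type_le[of n b] by (intro mult_right_mono) (simp_all only: of_nat_le_iff lessThan_iff)
  qed
  finally show ?thesis by (simp add: sum_distrib_left)
qed

text \<open>The eight limiting ratios are strictly below 1, hence so is their maximum M; any \<rho>
  strictly between M and 1 leaves room for the convergence of \<open>edge_scale\<close>.\<close>

lemma uniform_contraction:
  assumes k: "5 \<le> k" "k \<le> 25"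
  obtains \<rho> where "0 \<le> \<rho>" "\<rho> < 1"
    "\<forall>\<^sub>F n in sequentially. \<forall>a<8.
       edge_scale k n * (\<Sum>b<8. edge_bound k (7 - a) b * real_of_int (weight b) ^ k) \<le> \<rho> * real_of_int (weight a) ^ k"
proof -
  define S where "S = (\<lambda>a. \<Sum>b<8. edge_bound k (7 - a) b * real_of_int (weight b) ^ k)"
  define W where "W = (\<lambda>a. real_of_int (weight a) ^ k)"
  define l where "l = 4 * clause_density k / 8 ^ (2 * k)"
  define M where "M = Max ((\<lambda>a. l * S a / W a) ` {..<8})"
  have W: "0 < W a" if "a < 8" for a using weight_bounds(1)[OF that] by (simp add: W_def)
  have S: "0 \<le> S a" if "a < 8" for a
    unfolding S_def using k that
    by (intro sum_nonneg mult_nonneg_nonneg edge_bound_nonneg zero_le_power) (auto intro: order_trans[OF _ weight_bounds(1)])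
  have l: "0 < l" by (simp add: l_def clause_density_def)
  have less: "l * S a < W a" if a: "a < 8" for a
  proof -
    have "25 * 2 ^ k * (\<Sum>b<8. (pair_count k (7 - a) b + pair_count k b (7 - a)) * weight b ^ k)
        < 9 * 8 ^ (2 * k) * weight (7 - (7 - a)) ^ k"
      by (rule row_inequality[OF k]) simp
    moreover have "7 - (7 - a) = a" using a by simp
    ultimately have "25 * 2 ^ k * (\<Sum>b<8. (pair_count k (7 - a) b + pair_count k b (7 - a)) * weight b ^ k)
        < 9 * 8 ^ (2 * k) * weight a ^ k" by simp
    then have "real_of_int (25 * 2 ^ k * (\<Sum>b<8. (pair_count k (7 - a) b + pair_count k b (7 - a)) * weight b ^ k))
        < real_of_int (9 * 8 ^ (2 * k) * weight a ^ k)" by (simp only: of_int_less_iff)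
    then have "25 * 2 ^ k * S a < 9 * 8 ^ (2 * k) * W a"
      by (simp add: S_def W_def edge_bound_def)
    then show ?thesis by (simp add: l_def clause_density_def field_simps)
  qed
  have M: "l * S a / W a \<le> M" if "a < 8" for a unfolding M_def using that by (intro Max_ge) auto
  have "(0 :: nat) \<in> {..<8}" by simp
  then have "{..<8 :: nat} \<noteq> {}" by blast
  then have "M < 1" unfolding M_def using less W by (subst Max_less_iff) auto
  have "0 \<le> l * S 0 / W 0" using l S[of 0] W[of 0] by simp
  then have "0 \<le> M" using M[of 0] by simp
  define \<rho> where "\<rho> = (1 + M) / 2"
  have \<rho>: "0 \<le> \<rho>" "\<rho> < 1" "M < \<rho>" using \<open>0 \<le> M\<close> \<open>M < 1\<close> by (simp_all add: \<rho>_def)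
  have "\<forall>\<^sub>F n in sequentially. \<forall>a\<in>{..<8}. edge_scale k n * S a \<le> \<rho> * W a"
  proof (rule eventually_ball_finite)
    show "\<forall>a\<in>{..<8}. \<forall>\<^sub>F n in sequentially. edge_scale k n * S a \<le> \<rho> * W a"
    proof
      fix a :: nat assume "a \<in> {..<8}"
      then have a: "a < 8" by simp
      have "l * S a / W a < \<rho>" using M[OF a] \<rho> by simp
      then have "l * S a < \<rho> * W a" using W[OF a] by (simp add: divide_less_eq)
      moreover have "(\<lambda>n. edge_scale k n * S a) \<longlonglongrightarrow> l * S a"
        unfolding l_def using k by (intro tendsto_mult edge_scale_limit tendsto_const) auto
      ultimately have "\<forall>\<^sub>F n in sequentially. edge_scale k n * S a < \<rho> * W a"
        by (intro order_tendstoD(2))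
      then show "\<forall>\<^sub>F n in sequentially. edge_scale k n * S a \<le> \<rho> * W a"
        by eventually_elim simp
    qed
  qed simp
  then have "\<forall>\<^sub>F n in sequentially. \<forall>a<8. edge_scale k n * S a \<le> \<rho> * W a"
    by (simp add: Ball_def)
  from this[unfolded S_def W_def] show thesis by (rule that[OF \<rho>(1,2)])
qed

lemma achlioptas_satisfiable_limit:
  assumes k: "5 \<le> k" "k \<le> 25"
  shows "(\<lambda>n. measure_pmf.prob (achlioptas_formula 2 k n (\<lambda>_. pick) (nat \<lfloor>clause_density k * real n\<rfloor>))
    {F. satisfiable F}) \<longlonglongrightarrow> 1"
proof -
  obtain \<rho> where \<rho>: "0 \<le> \<rho>" "\<rho> < 1" and ev: "\<forall>\<^sub>F n in sequentially. \<forall>a<8.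
      edge_scale k n * (\<Sum>b<8. edge_bound k (7 - a) b * real_of_int (weight b) ^ k) \<le> \<rho> * real_of_int (weight a) ^ k"
    using uniform_contraction[OF k] by blast
  define m where "m = (\<lambda>n. nat \<lfloor>clause_density k * real n\<rfloor>)"
  define R :: real where "R = 49 ^ k"
  \<comment> \<open>Obtained from the general bound with 2 * n literals and \<kappa> = 4 * R / n, as
    2 * 2 * 16 = 64.\<close>
  define C where "C = 64 * R ^ 4 / (1 - \<rho>) ^ 4"
  define x where "x = (\<lambda>l. real_of_int (weight (lit_type l)) ^ k)"
  have bound: "measure_pmf.prob (achlioptas_formula 2 k n (\<lambda>_. pick) (m n)) {F. \<not> satisfiable F} \<le> C / real n"
    if n: "k < n" and evn: "\<forall>a<8. edge_scale k n * (\<Sum>b<8. edge_bound k (7 - a) b * real_of_int (weight b) ^ k)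
      \<le> \<rho> * real_of_int (weight a) ^ k" for n
  proof -
    define c where "c = real (n div 4 + 1)"
    define w where "w = (\<lambda>u v. real (m n) * measure_pmf.prob (pair_dist n k) (edge_event u v))"
    define W where "W = (\<lambda>b. real_of_int (weight b) ^ k)"
    have c: "0 < c" "real n / 4 \<le> c" unfolding c_def by linarith+
    have W: "1 \<le> W b" "W b \<le> R" if "b < 8" for b
    proof -
      have "1 \<le> real_of_int (weight b)" "real_of_int (weight b) \<le> 49"
        using weight_bounds[OF that] by simp_all
      then show "1 \<le> W b" "W b \<le> R" unfolding W_def R_def by (auto intro: power_mono)
    qed
    have e0: "0 \<le> edge_bound k (7 - a) b" if "b < 8" for a b
      using that k by (intro edge_bound_nonneg) auto
    have s0: "0 \<le> edge_scale k n" by (simp add: edge_scale_def clause_density_def)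
    have w: "w u v \<le> edge_scale k n * edge_bound k (7 - lit_type u) (lit_type v) / c" for u v
      unfolding w_def m_def c_def using k n by (intro edge_weight_le) auto
    have row_types: "edge_scale k n * (\<Sum>b<8. edge_bound k (7 - a) b * W b) \<le> \<rho> * W a" if "a < 8" for a
      using evn that by (simp add: W_def)
    have xW: "x v = W (lit_type v)" for v by (simp add: x_def W_def)
    have row: "(\<Sum>v\<in>lits n. w u v * x v) \<le> \<rho> * x u" for u
    proof -
      have "(\<Sum>v\<in>lits n. w u v * x v)
          \<le> (\<Sum>v\<in>lits n. edge_scale k n / c * (edge_bound k (7 - lit_type u) (lit_type v) * W (lit_type v)))"
      proof (rule sum_mono)
        fix v
        have "w u v * x v \<le> (edge_scale k n * edge_bound k (7 - lit_type u) (lit_type v) / c) * W (lit_type v)"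
          unfolding xW
          using W(1)[OF lit_type_less, of v] by (intro mult_right_mono w) simp
        then show "w u v * x v \<le> edge_scale k n / c * (edge_bound k (7 - lit_type u) (lit_type v) * W (lit_type v))"
          by (simp add: mult_ac)
      qed
      also have "\<dots> = edge_scale k n / c * (\<Sum>v\<in>lits n. edge_bound k (7 - lit_type u) (lit_type v) * W (lit_type v))"
        by (simp only: sum_distrib_left)
      also have "\<dots> \<le> edge_scale k n / c * (c * (\<Sum>b<8. edge_bound k (7 - lit_type u) b * W b))"
        unfolding c_def
        using s0 e0 W(1) by (intro mult_left_mono sum_lits_by_type mult_nonneg_nonneg divide_nonneg_nonneg)
          (auto intro: order_trans[OF zero_le_one])
      also have "\<dots> = edge_scale k n * (\<Sum>b<8. edge_bound k (7 - lit_type u) b * W b)"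
        using c by simp
      also have "\<dots> \<le> \<rho> * W (lit_type u)" by (rule row_types[OF lit_type_less])
      finally show ?thesis by (simp add: x_def W_def)
    qed
    \<comment> \<open>A single entry is at most its weighted row sum, all weights being at least 1,
      so the row inequality bounds it as well.\<close>
    have \<kappa>: "w u v \<le> 4 * R / real n" for u v
    proof -
      define a where "a = lit_type u"
      define b where "b = lit_type v"
      have ab: "a < 8" "b < 8" by (simp_all add: a_def b_def lit_type_less)
      have "edge_bound k (7 - a) b \<le> edge_bound k (7 - a) b * W b"
        using mult_left_mono[OF W(1)[OF ab(2)] e0[OF ab(2), of a]] by simp
      also have "\<dots> \<le> (\<Sum>b<8. edge_bound k (7 - a) b * W b)"
        using ab e0 W(1) by (intro member_le_sum mult_nonneg_nonneg) (auto intro: order_trans[OF zero_le_one])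
      finally have "edge_scale k n * edge_bound k (7 - a) b \<le> edge_scale k n * (\<Sum>b<8. edge_bound k (7 - a) b * W b)"
        using s0 by (rule mult_left_mono)
      also have "\<dots> \<le> \<rho> * W a" by (rule row_types[OF ab(1)])
      also have "\<dots> \<le> 1 * R" using \<rho> W[OF ab(1)] by (intro mult_mono) auto
      finally have "edge_scale k n * edge_bound k (7 - a) b / c \<le> R / c" using c by (simp add: divide_right_mono)
      also have "\<dots> \<le> R / (real n / 4)" using c n by (intro divide_left_mono) (auto simp: R_def)
      finally show ?thesis using w[of u v] unfolding a_def b_def by (simp add: mult.commute)
    qed
    have "measure_pmf.prob (achlioptas_formula 2 k n (\<lambda>_. pick) (m n)) {F. \<not> satisfiable F}
        \<le> measure_pmf.prob (replicate_pmf (m n) (pair_dist n k)) {\<omega>. \<not> sat2 (set \<omega>)}"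
      using k n by (intro prob_achlioptas_unsat_le) auto
    also have "\<dots> \<le> real (card (lits n)) * 2 * (4 * R / real n)\<^sup>2 * R\<^sup>2 / (1 - \<rho>) ^ 4"
    proof (rule prob_not_sat2_le[where x = x])
      show "neg ` lits n \<subseteq> lits n" by (auto simp: lits_def neg_def)
      show "set_pmf (pair_dist n k) \<subseteq> {(u, v). u \<in> lits n \<and> v \<in> lits n \<and> fst u \<noteq> fst v}"
        using k n by (intro pair_dist_support) auto
      show "(\<Sum>v\<in>lits n. real (m n) * measure_pmf.prob (pair_dist n k) (edge_event u v) * x v) \<le> \<rho> * x u" for u
        using row[of u] by (simp add: w_def)
      show "real (m n) * measure_pmf.prob (pair_dist n k) (edge_event u v) \<le> 4 * R / real n" for u v
        using \<kappa>[of u v] by (simp add: w_def)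
      show "1 \<le> x u" "x u \<le> R" for u
        using W[OF lit_type_less, of u] by (simp_all add: x_def W_def)
    qed (use \<rho> in \<open>auto simp: R_def\<close>)
    also have "\<dots> = C / real n"
      using n by (simp add: C_def card_lits power2_eq_square power4_eq_xxxx mult_ac)
    finally show ?thesis .
  qed
  have lim: "(\<lambda>n. measure_pmf.prob (achlioptas_formula 2 k n (\<lambda>_. pick) (m n)) {F. \<not> satisfiable F}) \<longlonglongrightarrow> 0"
  proof (rule tendsto_sandwich[OF _ _ tendsto_const])
    show "\<forall>\<^sub>F n in sequentially. measure_pmf.prob (achlioptas_formula 2 k n (\<lambda>_. pick) (m n)) {F. \<not> satisfiable F} \<le> C / real n"
      using ev eventually_gt_at_top[of k] by eventually_elim (rule bound)
    show "(\<lambda>n. C / real n) \<longlonglongrightarrow> 0" by real_asymp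
  qed simp
  have "measure_pmf.prob q {F. satisfiable F} = 1 - measure_pmf.prob q {F. \<not> satisfiable F}" for q
    using measure_pmf.prob_compl[of "{F. \<not> satisfiable F}" q] by (simp add: Compl_eq_Diff_UNIV[symmetric] Collect_neg_eq)
  then show ?thesis using tendsto_diff[OF tendsto_const lim, of 1] by (simp add: m_def)
qed

theorem theorem2:
  fixes k :: nat
  assumes "5 \<le> k" and "k \<le> 25"
  shows "\<exists>(\<alpha>::real) (S :: nat \<Rightarrow> strategy).
    \<alpha> > 0 \<and> (\<forall>n. is_strategy 2 (S n)) \<and>
    (\<lambda>n. measure_pmf.prob (random_formula k n (nat \<lfloor>\<alpha> * real n\<rfloor>))
            {F. \<not> satisfiable F}) \<longlonglongrightarrow> 1 \<and>
    (\<lambda>n. measure_pmf.prob (achlioptas_formula 2 k n (S n) (nat \<lfloor>\<alpha> * real n\<rfloor>))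
            {F. satisfiable F}) \<longlonglongrightarrow> 1"
proof (intro exI conjI)
  show "0 < clause_density k" by (simp add: clause_density_def)
  show "\<forall>n. is_strategy 2 (\<lambda>_. pick)"
    by (auto simp: is_strategy_def pick_def)
  show "(\<lambda>n. measure_pmf.prob (random_formula k n (nat \<lfloor>clause_density k * real n\<rfloor>))
      {F. \<not> satisfiable F}) \<longlonglongrightarrow> 1"
    by (rule random_formula_unsatisfiable_limit) (use assms in \<open>simp_all add: clause_density_def\<close>)
  show "(\<lambda>n. measure_pmf.prob (achlioptas_formula 2 k n (\<lambda>_. pick) (nat \<lfloor>clause_density k * real n\<rfloor>))
      {F. satisfiable F}) \<longlonglongrightarrow> 1"
    by (rule achlioptas_satisfiable_limit[OF assms])
qed

end
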